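(* Let $n,p\in\mathbb{N}$, $\mu\in\mathbb{C}$, $\alpha\ge 0$, $\beta\in\mathbb{R}$, $-1\le B\le 1$, $A\in\mathbb{R}$, $A\neq B$, and $\alpha+i\beta\neq 0$. If $f\in N_{p,\mu}^{n}(\alpha,\beta,A,B)$, then (as functions of $z\in\mathbb{U}$) $$\left(\frac{z^{p}}{f(z)}\right)^{\alpha+i\beta}\prec\frac{p(\alpha+i\beta)}{\mu n}\int_{0}^{1}\frac{1+Azu}{1+Bzu}\,u^{\frac{p(\alpha+i\beta)}{\mu n}-1}\,du\prec\frac{1+Az}{1+Bz}.$$
   Context: $\mathbb{U}=\{z\in\mathbb{C}:|z|<1\}$ and $\mathbb{N}=\{1,2,3,\dots\}$. For $p,n\in\mathbb{N}$, $\mathcal{A}_p$ is the class of functions $f(z)=z^{p}+\sum_{k=n}^{\infty}a_{k+p}z^{k+p}$ that are analytic and $p$-valent in $\mathbb{U}$ ($p$-valent: no value is taken more than $p$ times, counted with multiplicity, and some value is taken exactly $p$ times). The function $z^p/f(z)$ is extended by the value $1$ at $z=0$. For $F,G$ analytic in $\mathbb{U}$, $F\prec G$ ($F$ is subordinate to $G$) means there is an analytic $w:\mathbb{U}\to\mathbb{C}$ with $w(0)=0$, $|w(z)|<1$ on $\mathbb{U}$, and $F(z)=G(w(z))$ for all $z\in\mathbb{U}$. $N_{p,\mu}^{n}(\alpha,\beta,A,B)$ is the class of $f\in\mathcal{A}_p$ such that $$(1+\mu)\left(\frac{z^{p}}{f(z)}\right)^{\alpha+i\beta}-\mu\left(\frac{zf'(z)}{pf(z)}\right)\left(\frac{z^{p}}{f(z)}\right)^{\alpha+i\beta}\prec\frac{1+Az}{1+Bz}\quad(z\in\mathbb{U}).$$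 All powers are principal values.
   Formalization: It is additionally assumed that μ ≠ 0 and that the displayed integral converges for every z in the disc (equivalently Re(p(α+iβ)/(μn)) > 0); otherwise the middle function is undefined, e.g. f(z)=z, p=n=α=1, β=0, μ=−1. *)

theory Defs
  imports "HOL-Complex_Analysis.Complex_Analysis"
begin

abbreviation unit_disc :: "complex set" where
  "unit_disc \<equiv> ball 0 1"

text \<open>Number of times the value \<open>v\<close> is taken in the unit disc, counted with multiplicity;
  meaningful only when the set of \<open>v\<close>-points is finite.\<close>

definition value_count :: "(complex \<Rightarrow> complex) \<Rightarrow> complex \<Rightarrow> int" where
  "value_count f v = (\<Sum>z \<in> {z \<in> unit_disc. f z = v}. zorder (\<lambda>x. f x - v) z)"

definition p_valent :: "nat \<Rightarrow> (complex \<Rightarrow> complex) \<Rightarrow> bool" where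
  "p_valent p f \<longleftrightarrow>
     (\<forall>v. finite {z \<in> unit_disc. f z = v} \<and> value_count f v \<le> int p) \<and>
     (\<exists>v. value_count f v = int p)"

definition class_A :: "nat \<Rightarrow> nat \<Rightarrow> (complex \<Rightarrow> complex) set" where
  "class_A p n = {f. f holomorphic_on unit_disc \<and> p_valent p f \<and>
     (\<exists>a :: nat \<Rightarrow> complex. \<forall>z \<in> unit_disc.
        ((\<lambda>k. a (k + p) * z ^ (k + p)) has_sum (f z - z ^ p)) {n..})}"

definition subordinate :: "(complex \<Rightarrow> complex) \<Rightarrow> (complex \<Rightarrow> complex) \<Rightarrow> bool"
    (infix "\<prec>\<prec>" 50) where
  "F \<prec>\<prec> G \<longleftrightarrow> F holomorphic_on unit_disc \<and> G holomorphic_on unit_disc \<and>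
     (\<exists>w. w holomorphic_on unit_disc \<and> w 0 = 0 \<and>
        (\<forall>z \<in> unit_disc. norm (w z) < 1 \<and> F z = G (w z)))"

text \<open>For \<open>f\<close> in \<open>class_A p n\<close> with \<open>p, n \<ge> 1\<close>, both \<open>z^p / f z\<close> and \<open>z f' z / (p f z)\<close> have
  a removable singularity with value 1 at the origin, which is put in explicitly here
  because \<open>0 / 0 = 0\<close> in HOL.\<close>

definition power_quot :: "nat \<Rightarrow> (complex \<Rightarrow> complex) \<Rightarrow> complex \<Rightarrow> complex" where
  "power_quot p f z = (if z = 0 then 1 else z ^ p / f z)"

definition log_deriv_quot :: "nat \<Rightarrow> (complex \<Rightarrow> complex) \<Rightarrow> complex \<Rightarrow> complex" where
  "log_deriv_quot p f z = (if z = 0 then 1 else z * deriv f z / (of_nat p * f z))"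

definition moebius_h :: "real \<Rightarrow> real \<Rightarrow> complex \<Rightarrow> complex" where
  "moebius_h A B z = (1 + of_real A * z) / (1 + of_real B * z)"

text \<open>On the complex numbers \<open>powr\<close> is the principal power.\<close>

definition class_N ::
  "nat \<Rightarrow> nat \<Rightarrow> complex \<Rightarrow> real \<Rightarrow> real \<Rightarrow> real \<Rightarrow> real \<Rightarrow> (complex \<Rightarrow> complex) set" where
  "class_N p n \<mu> \<alpha> \<beta> A B = {f \<in> class_A p n.
     (\<lambda>z. (1 + \<mu>) * power_quot p f z powr Complex \<alpha> \<beta>
          - \<mu> * log_deriv_quot p f z * power_quot p f z powr Complex \<alpha> \<beta>)
       \<prec>\<prec> moebius_h A B}"

end

theory Submission
  imports Defs
begin

text \<open>Let \<open>c = \<alpha> + i \<beta>\<close>, \<open>\<gamma> = p c / (\<mu> n)\<close>, \<open>h = moebius_h A B\<close> and \<open>P = (z ^ p / f) powr c\<close>. The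
  hypothesis says \<open>P + z P' / (n \<gamma>) \<prec>\<prec> h\<close>, and the integral is the solution \<open>Q\<close> of
  \<open>Q + z Q' / \<gamma> = h\<close>; its existence at \<open>z = 0\<close> means \<open>Re \<gamma> > 0\<close>. The function \<open>Q\<close> is univalent
  because \<open>Re (Q' / (\<gamma> h')) > 0\<close> and \<open>h\<close> is convex. If \<open>w = inv Q \<circ> P\<close> attains its maximal modulus on
  a circle at \<open>z\<close>, then by Jack's lemma \<open>z w' = m w\<close> with \<open>m \<ge> n\<close>, so
  \<open>P + z P' / (n \<gamma>) = h \<zeta> + (m / n - 1) \<zeta> Q' \<zeta> / \<gamma>\<close> with \<open>\<zeta> = w z\<close>. This point lies on the
  outer side of the tangent to the boundary of \<open>h ` ball 0 (norm \<zeta>)\<close>, which by Schwarz' lemma yields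
  \<open>norm \<zeta> \<le> norm z ^ n\<close>. The second subordination follows in the same way from \<open>inv h \<circ> Q\<close>.\<close>

subsection \<open>Maxima of holomorphic functions and Euler's equation\<close>

lemma has_real_derivative_ray:
  fixes f :: "complex \<Rightarrow> complex"
  assumes "(f has_field_derivative D) (at a)"
  shows "((\<lambda>t::real. Re (f (a + of_real t * v))) has_real_derivative Re (v * D)) (at 0)"
proof -
  have "((\<lambda>t::real. a + of_real t * v) has_vector_derivative v) (at 0)"
    by (auto intro!: derivative_eq_intros has_vector_derivative_real_field)
  moreover have "(f has_field_derivative D) (at (a + of_real 0 * v))"
    using assms by simp
  ultimately have "((f \<circ> (\<lambda>t::real. a + of_real t * v)) has_vector_derivative v * D) (at 0)"
    by (rule field_vector_diff_chain_at)
  hence "((\<lambda>t. Re ((f \<circ> (\<lambda>t::real. a + of_real t * v)) t)) has_vector_derivative Re (v * D)) (at 0)"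
    by (rule bounded_linear.has_vector_derivative[OF bounded_linear_Re])
  thus ?thesis
    by (simp add: has_real_derivative_iff_has_vector_derivative o_def)
qed

lemma norm_ray_less:
  assumes "Re v < 0" "a \<noteq> 0"
  shows "\<forall>\<^sub>F t::real in at_right 0. norm (a + of_real t * (a * v)) < norm a"
proof -
  \<comment> \<open>The positive zero in \<open>t\<close> of \<open>2 Re v + t (norm v)^2\<close>,
    the factor that decides whether \<open>norm (1 + t v)\<close> is below 1.\<close>
  define d where "d = - 2 * Re v / (norm v)\<^sup>2"
  have "v \<noteq> 0" using assms by auto
  hence d: "d > 0" using assms by (simp add: d_def divide_neg_pos)
  have "norm (1 + of_real t * v) < 1" if "0 < t" "t < d" for t
  proof -
    have "(norm (1 + of_real t * v))\<^sup>2 = 1 + t * (2 * Re v + t * (norm v)\<^sup>2)"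
      unfolding cmod_power2 by (simp add: power2_eq_square algebra_simps)
    also have "\<dots> < 1"
    proof -
      have "t * (norm v)\<^sup>2 < - 2 * Re v"
        using that \<open>v \<noteq> 0\<close> unfolding d_def by (simp add: field_simps)
      thus ?thesis using that by (simp add: mult_pos_neg)
    qed
    finally show ?thesis by (simp add: power_less_one_iff abs_square_less_1)
  qed
  moreover have "norm (a + of_real t * (a * v)) = norm a * norm (1 + of_real t * v)" for t
    by (simp add: norm_mult[symmetric] algebra_simps)
  ultimately have "norm (a + of_real t * (a * v)) < norm a" if "0 < t" "t < d" for t
    using that assms by simp
  thus ?thesis unfolding eventually_at_right_field using d by blast
qed

text \<open>If \<open>Re (a v D)\<close> were positive for some \<open>v\<close> with
  \<open>Re v < 0\<close>, then \<open>Re f\<close> would increase along a ray from \<open>a\<close>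
  into the disc. A number \<open>a D\<close> that every such \<open>v\<close> turns into the closed
  left half-plane is real and nonnegative.\<close>

lemma deriv_at_max_Re:
  fixes f :: "complex \<Rightarrow> complex"
  assumes der: "(f has_field_derivative D) (at a)"
    and max: "\<And>z. norm z < norm a \<Longrightarrow> Re (f z) \<le> Re (f a)"
  shows "Im (a * D) = 0" "Re (a * D) \<ge> 0"
proof -
  have neg: "Re (a * v * D) \<le> 0" if v: "Re v < 0" for v
  proof (cases "a = 0")
    case False
    show ?thesis
    proof (rule ccontr)
      assume "\<not> ?thesis"
      hence "Re (a * v * D) > 0" by simp
      from has_real_derivative_pos_inc_right[OF has_real_derivative_ray[OF der] this]
      obtain d where d: "d > 0"
        "\<And>h. h > 0 \<Longrightarrow> h < d \<Longrightarrow> Re (f a) < Re (f (a + of_real h * (a * v)))"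
        by auto
      have "\<forall>\<^sub>F t::real in at_right 0. norm (a + of_real t * (a * v)) < norm a \<and> 0 < t \<and> t < d"
        using norm_ray_less[OF v False] eventually_at_right_real[OF d(1)]
        by eventually_elim auto
      from eventually_happens[OF this] obtain t :: real
        where "norm (a + of_real t * (a * v)) < norm a" "0 < t" "t < d"
        by auto
      thus False using max[of "a + of_real t * (a * v)"] d(2)[of t] by auto
    qed
  qed auto
  show "Re (a * D) \<ge> 0" using neg[of "-1"] by simp
  define X where "X = a * D"
  \<comment> \<open>Nearly tangential directions: \<open>s\<close> equal to 1 or -1 and
    \<open>e\<close> tending to 0 squeeze \<open>Im X\<close> to 0.\<close>
  have *: "- e * Re X - s * Im X \<le> 0" if "e > 0" for e s
    using neg[of "Complex (-e) s"] that by (simp add: X_def algebra_simps)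
  have "\<bar>Im X\<bar> \<le> 0"
  proof (rule field_le_epsilon)
    fix e :: real assume e: "e > 0"
    define e' where "e' = e / (\<bar>Re X\<bar> + 1)"
    have "e' > 0" "e' * \<bar>Re X\<bar> \<le> e"
      using e by (auto simp: e'_def field_simps add_pos_nonneg)
    moreover have "e' * Re X \<le> e' * \<bar>Re X\<bar>" using \<open>e' > 0\<close> by simp
    ultimately show "\<bar>Im X\<bar> \<le> 0 + e"
      using *[OF \<open>e' > 0\<close>, of 1] *[OF \<open>e' > 0\<close>, of "-1"]
      by (simp only: minus_mult_left [symmetric])
  qed
  thus "Im (a * D) = 0" by (simp add: X_def)
qed

text \<open>Solved by comparing Taylor coefficients: those of the solution are
  \<open>\<gamma> / (\<gamma> + k)\<close> times those of \<open>H\<close>.\<close>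

lemma euler_equation_solvable:
  fixes H :: "complex \<Rightarrow> complex"
  assumes holH: "H holomorphic_on ball 0 r" and \<gamma>: "Re \<gamma> > 0"
  shows "\<exists>Q. Q holomorphic_on ball 0 r \<and> (\<forall>z\<in>ball 0 r. Q z + z * deriv Q z / \<gamma> = H z)"
proof -
  define a where "a k = (deriv ^^ k) H 0 / fact k" for k
  define b where "b k = \<gamma> / (\<gamma> + of_nat k) * a k" for k
  have nz: "\<gamma> + of_nat k \<noteq> 0" for k
    using \<gamma> by (metis Re_complex_of_real add_pos_nonneg less_numeral_extra(3) of_nat_0_le_iff
        of_real_of_nat_eq plus_complex.sel(1) zero_complex.sel(1))
  have \<gamma>0: "\<gamma> \<noteq> 0" using \<gamma> by auto
  have a: "(\<lambda>k. a k * z ^ k) sums H z" if "z \<in> ball 0 r" for z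
    using holomorphic_power_series[OF holH that] by (simp add: a_def)
  \<comment> \<open>Absolute convergence and termwise differentiation at \<open>z\<close> are
    derived from convergence at a point of larger modulus.\<close>
  have between: "\<exists>x::complex. norm z < norm x \<and> x \<in> ball 0 r" if "z \<in> ball 0 r" for z :: complex
  proof -
    have "norm z < (norm z + r) / 2" "(norm z + r) / 2 < r" using that by auto
    moreover from this have "0 \<le> (norm z + r) / 2" by (meson norm_ge_zero order_trans less_imp_le)
    ultimately show ?thesis
      by (intro exI[of _ "complex_of_real ((norm z + r) / 2)"])
        (simp del: of_real_add of_real_divide)
  qed
  \<comment> \<open>As \<open>Re \<gamma> > 0\<close>, adding \<open>k\<close> does not bring
    \<open>\<gamma>\<close> closer to 0, so the coefficients \<open>b\<close> are dominated by
    \<open>a\<close>.\<close>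
  have le: "norm (\<gamma> / (\<gamma> + of_nat k)) \<le> 1" for k
  proof -
    have "norm \<gamma> \<le> norm (\<gamma> + of_nat k)"
      using \<gamma> by (auto simp: cmod_def intro!: power_mono)
    thus ?thesis using nz[of k] by (simp add: norm_divide divide_le_eq_1)
  qed
  have sb: "summable (\<lambda>k. b k * z ^ k)" if z: "z \<in> ball 0 r" for z
  proof -
    obtain x :: complex where x: "norm z < norm x" "x \<in> ball 0 r" using between[OF z] by blast
    have "summable (\<lambda>k. norm (a k * z ^ k))"
      using powser_insidea[OF sums_summable[OF a[OF x(2)]] x(1)] .
    moreover have "norm (b k * z ^ k) \<le> norm (a k * z ^ k)" for k
      using mult_right_mono[OF le[of k] norm_ge_zero[of "a k * z ^ k"]]
      by (simp only: b_def norm_mult mult.assoc mult_1_left)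
    ultimately show ?thesis
      by (rule_tac summable_norm_cancel[OF summable_comparison_test']) auto
  qed
  define Q where "Q z = (\<Sum>k. b k * z ^ k)" for z
  have "Q z + z * deriv Q z / \<gamma> = H z" if z: "z \<in> ball 0 r" for z
  proof -
    obtain x :: complex where x: "norm z < norm x" "x \<in> ball 0 r" using between[OF z] by blast
    have D: "(Q has_field_derivative (\<Sum>k. diffs b k * z ^ k)) (at z)"
      unfolding Q_def[abs_def] by (rule termdiffs_strong[OF sb[OF x(2)] x(1)])
    have "summable (\<lambda>k. diffs b k * z ^ k)"
      by (rule termdiff_converges[of _ "norm x"]) (use x sb in \<open>auto\<close>)
    from sums_mult[OF diffs_equiv[OF this], of z]
    have "(\<lambda>k. z * (of_nat k * b k * z ^ (k - Suc 0))) sums (z * deriv Q z)"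
      using DERIV_imp_deriv[OF D] by simp
    moreover have "z * (of_nat k * b k * z ^ (k - Suc 0)) = of_nat k * b k * z ^ k" for k
      by (cases k) auto
    ultimately have "(\<lambda>k. of_nat k * b k * z ^ k) sums (z * deriv Q z)" by simp
    from sums_add[OF summable_sums[OF sb[OF z]] sums_divide[OF this, of \<gamma>]]
    have "(\<lambda>k. b k * z ^ k + of_nat k * b k * z ^ k / \<gamma>) sums (Q z + z * deriv Q z / \<gamma>)"
      by (simp add: Q_def)
    moreover have "b k * z ^ k + of_nat k * b k * z ^ k / \<gamma> = a k * z ^ k" for k
    proof -
      have "b k * z ^ k + of_nat k * b k * z ^ k / \<gamma> = b k * ((\<gamma> + of_nat k) / \<gamma>) * z ^ k"
        using \<gamma>0 by (simp add: field_simps)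
      also have "b k * ((\<gamma> + of_nat k) / \<gamma>) = a k"
        using nz[of k] \<gamma>0 by (simp add: b_def)
      finally show ?thesis .
    qed
    ultimately show ?thesis using sums_unique2[OF _ a[OF z]] by simp
  qed
  moreover have "Q holomorphic_on ball 0 r"
    by (rule power_series_holomorphic[where a = b]) (use sb in \<open>auto simp: Q_def summable_sums\<close>)
  ultimately show ?thesis by blast
qed

text \<open>For the parameter \<open>m + 1\<close> and the right-hand side
  \<open>G / (m + 1)\<close>, a solution \<open>H\<close> of Euler's equation satisfies
  \<open>(z ^ (m + 1) * H)' = z ^ m * G\<close>, so \<open>F\<close> and
  \<open>z ^ (m + 1) * H\<close> differ by a constant.\<close>

lemma diff_at_0_factor:
  fixes F G :: "complex \<Rightarrow> complex"
  assumes F: "F holomorphic_on ball 0 r" and G: "G holomorphic_on ball 0 r"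
    and der: "\<And>z. z \<in> ball 0 r \<Longrightarrow> deriv F z = z ^ m * G z"
  shows "\<exists>H. H holomorphic_on ball 0 r \<and> (\<forall>z\<in>ball 0 r. F z = F 0 + z ^ Suc m * H z)"
proof -
  have "(\<lambda>z. G z / of_nat (Suc m)) holomorphic_on ball 0 r"
    by (intro holomorphic_intros G) (auto simp del: of_nat_Suc)
  from euler_equation_solvable[OF this, of "of_nat (Suc m)"] obtain H
    where H: "H holomorphic_on ball 0 r"
      "\<And>z. z \<in> ball 0 r \<Longrightarrow> H z + z * deriv H z / of_nat (Suc m) = G z / of_nat (Suc m)"
    by auto
  have "\<exists>c. \<forall>z\<in>ball 0 r. F z - z ^ Suc m * H z = c"
  proof (rule has_field_derivative_zero_constant)
    fix z :: complex assume z: "z \<in> ball 0 r"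
    have "(F has_field_derivative deriv F z) (at z)" "(H has_field_derivative deriv H z) (at z)"
      using F H(1) z by (auto intro: holomorphic_derivI[OF _ open_ball])
    hence "((\<lambda>z. F z - z ^ Suc m * H z) has_field_derivative
        deriv F z - (of_nat (Suc m) * z ^ m * H z + z ^ Suc m * deriv H z)) (at z)"
      by (auto intro!: derivative_eq_intros simp del: power_Suc of_nat_Suc)
    moreover have "of_nat (Suc m) * z ^ m * H z + z ^ Suc m * deriv H z = z ^ m * G z"
    proof -
      have "of_nat (Suc m) * H z + z * deriv H z = G z"
        using H(2)[OF z] of_nat_neq_0[of m, where ?'a = complex]
        by (simp add: field_simps del: of_nat_Suc)
      moreover have "of_nat (Suc m) * z ^ m * H z + z ^ Suc m * deriv H z
          = z ^ m * (of_nat (Suc m) * H z + z * deriv H z)"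
        by (simp add: algebra_simps del: of_nat_Suc)
      ultimately show ?thesis by simp
    qed
    ultimately show "((\<lambda>z. F z - z ^ Suc m * H z) has_field_derivative 0) (at z within ball 0 r)"
      using der[OF z] by (auto intro: has_field_derivative_at_within)
  qed auto
  then obtain c where c: "\<And>z. z \<in> ball 0 r \<Longrightarrow> F z - z ^ Suc m * H z = c" by blast
  have "F z = F 0 + z ^ Suc m * H z" if "z \<in> ball 0 r" for z
  proof -
    have "(0::complex) \<in> ball 0 r" using that by (auto intro: le_less_trans[OF norm_ge_zero])
    from c[OF this] c[OF that] show ?thesis by (simp add: algebra_simps)
  qed
  thus ?thesis using H(1) by blast
qed

text \<open>Even a conditionally convergent integral forces \<open>Re \<gamma> > 0\<close>: the limit \<open>L\<close> of
  \<open>\<epsilon> powr \<gamma>\<close> at \<open>0\<close> satisfies \<open>L = (exp (-1 / norm \<gamma>) powr \<gamma>) * L\<close>, so \<open>L = 0\<close>.\<close>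

lemma Re_pos_if_powr_integrable:
  fixes \<gamma> :: complex
  assumes int: "(\<lambda>u::real. of_real u powr (\<gamma> - 1)) integrable_on {0..1}" and "\<gamma> \<noteq> 0"
  shows "Re \<gamma> > 0"
proof -
  define g where "g = (\<lambda>u::real. of_real u powr (\<gamma> - 1))"
  have I: "integral {e..1} g = (1 - of_real e powr \<gamma>) / \<gamma>" if e: "0 < e" "e \<le> 1" for e :: real
  proof -
    have "((\<lambda>u. of_real u powr \<gamma> / \<gamma>) has_vector_derivative g u) (at u)"
      if "u \<in> {e<..<1}" for u
    proof (rule has_vector_derivative_real_field)
      show "((\<lambda>u. u powr \<gamma> / \<gamma>) has_field_derivative g u) (at (of_real u))"
        using that e \<open>\<gamma> \<noteq> 0\<close> by (auto simp: g_def intro!: derivative_eq_intros)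
    qed
    moreover have "continuous_on {e..1} (\<lambda>u::real. of_real u powr \<gamma> / \<gamma>)"
      using e \<open>\<gamma> \<noteq> 0\<close> by (auto intro!: continuous_intros)
    ultimately have "(g has_integral (of_real 1 powr \<gamma> / \<gamma> - of_real e powr \<gamma> / \<gamma>)) {e..1}"
      using e by (intro fundamental_theorem_of_calculus_interior) auto
    thus ?thesis by (simp add: integral_unique diff_divide_distrib)
  qed
  \<comment> \<open>By \<open>I\<close> this is the limit of \<open>e powr \<gamma>\<close> as
    \<open>e\<close> tends to 0, the integral being continuous in its lower limit.\<close>
  define L where "L = 1 - \<gamma> * integral {0..1} g"
  have "continuous_on {0..1} (\<lambda>x. integral {x..1} g)"
    using int unfolding g_def by (rule indefinite_integral_continuous_1')
  hence "((\<lambda>x. integral {x..1} g) \<longlongrightarrow> integral {0..1} g) (at 0 within {0..1})"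
    by (simp add: continuous_on_def)
  hence "((\<lambda>x. integral {x..1} g) \<longlongrightarrow> integral {0..1} g) (at_right 0)"
    by (simp add: at_within_Icc_at_right)
  hence "((\<lambda>x. 1 - \<gamma> * integral {x..1} g) \<longlongrightarrow> L) (at_right 0)"
    unfolding L_def by (intro tendsto_intros)
  moreover have "\<forall>\<^sub>F x in at_right 0. 1 - \<gamma> * integral {x..1} g = of_real x powr \<gamma>"
    using eventually_at_right_real[OF zero_less_one] by eventually_elim (use I \<open>\<gamma> \<noteq> 0\<close> in auto)
  ultimately have lim: "((\<lambda>x::real. of_real x powr \<gamma>) \<longlongrightarrow> L) (at_right 0)"
    by (rule Lim_transform_eventually)
  \<comment> \<open>With this \<open>d\<close>, the power \<open>d powr \<gamma>\<close> is
    \<open>exp\<close> of a number of modulus 1. Such a number is nonzero and too short to be a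
    period of \<open>exp\<close>, so the power is not 1.\<close>
  define d :: real where "d = exp (- 1 / norm \<gamma>)"
  have d: "d > 0" by (simp add: d_def)
  have "filterlim (\<lambda>x. d * x) (at_right 0) (at_right 0)"
    using filterlim_times_pos[of "\<lambda>x. x" 0 "at_right 0" d 0] d
    by (simp add: filterlim_ident)
  from filterlim_compose[OF lim this]
  have "((\<lambda>x::real. of_real (d * x) powr \<gamma>) \<longlongrightarrow> L) (at_right 0)" .
  moreover have "\<forall>\<^sub>F x in at_right (0::real). of_real (d * x) powr \<gamma> = of_real d powr \<gamma> * of_real x powr \<gamma>"
    using eventually_at_right_less[of 0]
    by eventually_elim (use d in \<open>simp add: powr_times_real\<close>)
  ultimately have "((\<lambda>x::real. of_real d powr \<gamma> * of_real x powr \<gamma>) \<longlongrightarrow> L) (at_right 0)"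
    by (rule Lim_transform_eventually)
  moreover have "((\<lambda>x::real. of_real d powr \<gamma> * of_real x powr \<gamma>) \<longlongrightarrow> of_real d powr \<gamma> * L) (at_right 0)"
    by (intro tendsto_intros lim)
  ultimately have "L = of_real d powr \<gamma> * L"
    using tendsto_unique trivial_limit_at_right_real by blast
  moreover have "of_real d powr \<gamma> \<noteq> 1"
  proof
    assume "of_real d powr \<gamma> = 1"
    hence "exp (\<gamma> * of_real (- 1 / norm \<gamma>)) = 1"
      by (simp add: powr_def d_def Ln_of_real)
    then obtain k :: int where k: "\<gamma> * of_real (- 1 / norm \<gamma>) = of_int (2 * k) * (of_real pi * \<i>)"
      unfolding exp_eq_1 by (metis Im_complex_of_real complex_eq mult.assoc mult.commute
        add_0 of_int_mult of_real_0 of_real_mult of_real_of_int_eq)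
    have "1 = norm (\<gamma> * of_real (- 1 / norm \<gamma>))"
      using \<open>\<gamma> \<noteq> 0\<close> by (simp add: norm_mult norm_divide)
    also have "\<dots> = 2 * \<bar>of_int k\<bar> * pi"
      unfolding k by (simp add: norm_mult)
    finally have *: "1 = 2 * \<bar>of_int k\<bar> * pi" .
    hence "k \<noteq> 0" by auto
    hence "\<bar>of_int k\<bar> \<ge> (1::real)" by linarith
    hence "2 * \<bar>of_int k\<bar> * pi \<ge> 2 * pi" by simp
    thus False using * pi_gt3 by linarith
  qed
  ultimately have "L = 0" by simp
  with lim have "((\<lambda>x::real. norm (of_real x powr \<gamma>)) \<longlongrightarrow> 0) (at_right 0)"
    using tendsto_norm_zero by blast
  hence "\<forall>\<^sub>F x::real in at_right 0. norm (of_real x powr \<gamma>) < 1"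
    by (rule order_tendstoD) simp
  hence "\<forall>\<^sub>F x::real in at_right 0. norm (of_real x powr \<gamma>) < 1 \<and> x \<in> {0<..<1}"
    using eventually_at_right_real[OF zero_less_one] by (auto intro: eventually_conj)
  from eventually_happens[OF this] obtain x :: real
    where x: "norm (of_real x powr \<gamma>) < 1" "0 < x" "x < 1"
    by auto
  have "x powr Re \<gamma> < 1" using x norm_powr_real_powr[of "of_real x" \<gamma>] by simp
  show ?thesis
  proof (rule ccontr)
    assume "\<not> ?thesis"
    hence "x powr 0 \<le> x powr Re \<gamma>" using x by (intro powr_mono') auto
    thus False using \<open>x powr Re \<gamma> < 1\<close> x by simp
  qed
qed

text \<open>By Euler's equation the integrand is the derivative of
  \<open>u powr \<gamma> / \<gamma> * Q (z u)\<close>. The lower limit contributes nothing since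
  \<open>0 powr \<gamma> = 0\<close>, and \<open>Re \<gamma> > 0\<close> makes this value the
  continuous one.\<close>

lemma euler_equation_integral:
  fixes Q H :: "complex \<Rightarrow> complex"
  assumes Q: "Q holomorphic_on ball 0 r" and \<gamma>: "Re \<gamma> > 0"
    and eq: "\<And>z. z \<in> ball 0 r \<Longrightarrow> Q z + z * deriv Q z / \<gamma> = H z"
    and z: "z \<in> ball 0 r"
  shows "((\<lambda>u::real. H (z * of_real u) * of_real u powr (\<gamma> - 1)) has_integral Q z / \<gamma>) {0..1}"
proof -
  have \<gamma>0: "\<gamma> \<noteq> 0" using \<gamma> by auto
  have zu: "z * of_real u \<in> ball 0 r" if "u \<in> {0..1}" for u :: real
    using z that mult_left_le[of u "norm z"] by (auto simp: norm_mult intro: le_less_trans)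
  define F where "F u = of_real u powr \<gamma> / \<gamma> * Q (z * of_real u)" for u :: real
  have "continuous_on {0..1} (\<lambda>u::real. of_real u powr \<gamma>)"
    by (rule continuous_on_powr_complex) (use \<gamma> in \<open>auto intro!: continuous_intros\<close>)
  moreover have "continuous_on {0..1} (\<lambda>u::real. Q (z * of_real u))"
    by (rule continuous_on_compose2[OF holomorphic_on_imp_continuous_on[OF Q]])
      (use zu in \<open>auto intro!: continuous_intros simp del: mem_ball\<close>)
  ultimately have "continuous_on {0..1} F"
    unfolding F_def using \<gamma>0 by (intro continuous_on_mult continuous_on_divide continuous_on_const) auto
  moreover have "(F has_vector_derivative H (z * of_real u) * of_real u powr (\<gamma> - 1)) (at u)"
    if u: "u \<in> {0<..<1}" for u
  proof -
    have "(Q has_field_derivative deriv Q (z * of_real u)) (at (z * of_real u))"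
      using Q zu[of u] u by (intro holomorphic_derivI[OF _ open_ball]) auto
    hence Q': "((\<lambda>x. Q (z * x)) has_field_derivative deriv Q (z * of_real u) * z) (at (of_real u))"
      by (rule DERIV_chain2) (auto intro!: derivative_eq_intros)
    have "((\<lambda>x. x powr \<gamma> / \<gamma> * Q (z * x)) has_field_derivative
        \<gamma> * of_real u powr (\<gamma> - 1) / \<gamma> * Q (z * of_real u) +
        deriv Q (z * of_real u) * z * (of_real u powr \<gamma> / \<gamma>)) (at (of_real u))"
      using u \<gamma>0 by (intro DERIV_mult Q' DERIV_cdivide has_field_derivative_powr) auto
    also have "of_real u powr \<gamma> = of_real u * of_real u powr (\<gamma> - 1)"
      using u by (simp add: powr_diff)
    finally have "((\<lambda>x. x powr \<gamma> / \<gamma> * Q (z * x)) has_field_derivative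
        (Q (z * of_real u) + z * of_real u * deriv Q (z * of_real u) / \<gamma>) * of_real u powr (\<gamma> - 1))
        (at (of_real u))"
      using \<gamma>0 by (simp add: field_simps)
    hence "((\<lambda>x. x powr \<gamma> / \<gamma> * Q (z * x)) has_field_derivative
        H (z * of_real u) * of_real u powr (\<gamma> - 1)) (at (of_real u))"
      using eq zu[of u] u by (auto simp del: mem_ball)
    thus ?thesis unfolding F_def by (rule has_vector_derivative_real_field)
  qed
  ultimately have "((\<lambda>u. H (z * of_real u) * of_real u powr (\<gamma> - 1)) has_integral F 1 - F 0) {0..1}"
    by (intro fundamental_theorem_of_calculus_interior) auto
  thus ?thesis by (simp add: F_def)
qed

subsection \<open>Moebius functions and univalence\<close>

lemma one_plus_mult_nonzero:
  fixes z :: complex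
  assumes "\<bar>B\<bar> \<le> 1" "norm z < 1"
  shows "1 + of_real B * z \<noteq> 0"
proof
  assume "1 + of_real B * z = 0"
  hence "1 = norm (of_real B * z)" by (metis add_eq_0_iff norm_minus_cancel norm_one)
  moreover have "norm (of_real B * z) \<le> norm z"
    using assms mult_right_mono[of "\<bar>B\<bar>" 1 "norm z"] by (simp add: norm_mult)
  ultimately show False using assms by simp
qed

lemma moebius_h_has_field_derivative:
  assumes "1 + of_real B * z \<noteq> 0"
  shows "(moebius_h A B has_field_derivative (of_real A - of_real B) / (1 + of_real B * z)\<^sup>2) (at z)"
  unfolding moebius_h_def[abs_def]
  by (rule derivative_eq_intros refl assms)+
    (use assms in \<open>simp add: field_simps power2_eq_square\<close>)

lemma moebius_h_holomorphic:
  assumes "\<bar>B\<bar> \<le> 1"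
  shows "moebius_h A B holomorphic_on unit_disc"
  unfolding moebius_h_def[abs_def]
  by (intro holomorphic_intros) (use one_plus_mult_nonzero[OF assms] in auto)

lemma moebius_h_diff:
  assumes "1 + of_real B * z \<noteq> 0" "1 + of_real B * w \<noteq> 0"
  shows "moebius_h A B w - moebius_h A B z
    = (of_real A - of_real B) * (w - z) / ((1 + of_real B * w) * (1 + of_real B * z))"
  using assms by (simp add: moebius_h_def field_simps)

lemma moebius_h_inj_on:
  assumes "\<bar>B\<bar> \<le> 1" "A \<noteq> B"
  shows "inj_on (moebius_h A B) unit_disc"
proof (rule inj_onI)
  fix w z :: complex
  assume "w \<in> unit_disc" "z \<in> unit_disc" and eq: "moebius_h A B w = moebius_h A B z"
  hence nz: "1 + of_real B * w \<noteq> 0" "1 + of_real B * z \<noteq> 0"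
    using one_plus_mult_nonzero assms by auto
  have "(of_real A - of_real B) * (w - z) / ((1 + of_real B * w) * (1 + of_real B * z)) = 0"
    using moebius_h_diff[OF nz(2,1), of A] eq by simp
  thus "w = z" using nz assms by auto
qed

text \<open>After multiplication by the conjugate denominator the real part is, for fixed moduli
  \<open>x\<close> of \<open>b\<close> and \<open>y\<close> of \<open>\<tau>\<close>, affine in
  \<open>Re b\<close> and \<open>Re \<tau>\<close>. It is smallest for \<open>b = - x\<close> and
  \<open>\<tau> = y\<close>, where it equals \<open>(1 - x) (1 - y) (1 - x y)\<close>.\<close>

lemma Re_moebius_pos:
  fixes b \<tau> :: complex
  assumes "norm b < 1" "norm \<tau> < 1"
  shows "Re ((1 - \<tau>) * (1 + b) / (1 + b * \<tau>)) > 0"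
proof -
  have "norm (b * \<tau>) < 1"
    using assms mult_strict_mono[of "norm b" 1 "norm \<tau>" 1] by (simp add: norm_mult)
  have nz: "1 + b * \<tau> \<noteq> 0"
    using \<open>norm (b * \<tau>) < 1\<close> by (metis add_eq_0_iff less_irrefl norm_minus_cancel norm_one)
  define x y where "x = norm b" and "y = norm \<tau>"
  have x: "0 \<le> x" "x < 1" "0 \<le> y" "y < 1" using assms by (auto simp: x_def y_def)
  have xy: "x * y < 1" using \<open>norm (b * \<tau>) < 1\<close> by (simp add: norm_mult x_def y_def)
  have sq: "(Re b)\<^sup>2 + (Im b)\<^sup>2 = x\<^sup>2" "(Re \<tau>)\<^sup>2 + (Im \<tau>)\<^sup>2 = y\<^sup>2"
    by (simp_all add: x_def y_def cmod_power2)
  have "Re ((1 - \<tau>) * (1 + b) * cnj (1 + b * \<tau>))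
      = 1 - ((Re b)\<^sup>2 + (Im b)\<^sup>2) * ((Re \<tau>)\<^sup>2 + (Im \<tau>)\<^sup>2)
        + Re b * (1 - ((Re \<tau>)\<^sup>2 + (Im \<tau>)\<^sup>2)) - Re \<tau> * (1 - ((Re b)\<^sup>2 + (Im b)\<^sup>2))"
    by (simp add: power2_eq_square algebra_simps)
  also have "\<dots> = 1 - x\<^sup>2 * y\<^sup>2 + Re b * (1 - y\<^sup>2) - Re \<tau> * (1 - x\<^sup>2)"
    by (simp only: sq)
  finally have eq: "Re ((1 - \<tau>) * (1 + b) * cnj (1 + b * \<tau>))
      = 1 - x\<^sup>2 * y\<^sup>2 + Re b * (1 - y\<^sup>2) - Re \<tau> * (1 - x\<^sup>2)" .
  have "0 < (1 - x) * (1 - y) * (1 - x * y)" using x xy by simp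
  also have "\<dots> = 1 - x\<^sup>2 * y\<^sup>2 + (- x) * (1 - y\<^sup>2) - y * (1 - x\<^sup>2)"
    by (simp add: power2_eq_square algebra_simps)
  also have "\<dots> \<le> 1 - x\<^sup>2 * y\<^sup>2 + Re b * (1 - y\<^sup>2) - Re \<tau> * (1 - x\<^sup>2)"
  proof -
    have "- x \<le> Re b" "Re \<tau> \<le> y"
      using abs_Re_le_cmod[of b] complex_Re_le_cmod[of \<tau>] by (auto simp: x_def y_def)
    moreover have "0 \<le> 1 - y\<^sup>2" "0 \<le> 1 - x\<^sup>2"
      using x by (auto intro: power_le_one)
    ultimately show ?thesis
      by (intro add_mono diff_mono mult_right_mono) auto
  qed
  finally show ?thesis unfolding Re_complex_div_gt_0 eq .
qed

text \<open>Convexity of the image of every disc \<open>ball 0 \<rho>\<close> under \<open>moebius_h A B\<close>: a point of its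
  boundary, moved by a vector on the outer side of the tangent line, leaves it.\<close>

lemma moebius_h_outward:
  fixes v z w :: complex
  assumes B: "\<bar>B\<bar> \<le> 1" and "A \<noteq> B" and z: "norm z < 1" and w: "norm w < norm z" and v: "Re v \<ge> 0"
  shows "moebius_h A B z + v * z * deriv (moebius_h A B) z \<noteq> moebius_h A B w"
proof
  assume eq: "moebius_h A B z + v * z * deriv (moebius_h A B) z = moebius_h A B w"
  have nz: "1 + of_real B * z \<noteq> 0" "1 + of_real B * w \<noteq> 0"
    using one_plus_mult_nonzero[OF B] z w by auto
  have "z \<noteq> 0" using w by auto
  define X Y where "X = 1 + of_real B * z" and "Y = 1 + of_real B * w"
  have nz': "X \<noteq> 0" "Y \<noteq> 0" using nz by (auto simp: X_def Y_def)
  define c :: complex where "c = of_real A - of_real B"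
  have c: "c \<noteq> 0" using \<open>A \<noteq> B\<close> by (simp add: c_def)
  have "v * z * (c / X\<^sup>2) = c * (w - z) / (Y * X)"
    using moebius_h_diff[OF nz, of A] eq DERIV_imp_deriv[OF moebius_h_has_field_derivative[OF nz(1), of A]]
    by (simp add: X_def Y_def c_def algebra_simps)
  hence "c * (v * z * Y) = c * ((w - z) * X)"
    using nz' by (simp add: field_simps power2_eq_square)
  hence "v * z * Y = (w - z) * X" using c by simp
  \<comment> \<open>Solved for \<open>v\<close>, this is minus the expression of
    \<open>Re_moebius_pos\<close> with \<open>b = B z\<close> and
    \<open>\<tau> = w / z\<close>.\<close>
  hence "v = - ((1 - w / z) * X / Y)"
    using nz' \<open>z \<noteq> 0\<close> by (simp add: field_simps)
  moreover have "Y = 1 + of_real B * z * (w / z)" using \<open>z \<noteq> 0\<close> by (simp add: Y_def)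
  moreover have "norm (of_real B * z) < 1"
    using z B mult_right_mono[OF B norm_ge_zero[of z]] by (simp add: norm_mult)
  moreover have "norm (w / z) < 1" using w \<open>z \<noteq> 0\<close> by (simp add: norm_divide)
  ultimately have "Re v < 0"
    using Re_moebius_pos[of "of_real B * z" "w / z"] by (simp add: X_def)
  thus False using v by simp
qed

section \<open>Univalence of the solution of Euler's equation\<close>

lemma norm_sq_convex_comb_le:
  fixes a b :: "'a::real_inner"
  assumes "0 \<le> s" "0 \<le> t" "s + t = 1"
  shows "(norm (s *\<^sub>R a + t *\<^sub>R b))\<^sup>2 \<le> s * (norm a)\<^sup>2 + t * (norm b)\<^sup>2"
proof -
  have "norm (s *\<^sub>R a + t *\<^sub>R b) \<le> s * norm a + t * norm b"
    using norm_triangle_ineq[of "s *\<^sub>R a" "t *\<^sub>R b"] assms by simp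
  hence "(norm (s *\<^sub>R a + t *\<^sub>R b))\<^sup>2 \<le> (s * norm a + t * norm b)\<^sup>2"
    by (intro power_mono) auto
  also have "\<dots> = s * (norm a)\<^sup>2 + t * (norm b)\<^sup>2 - s * t * (norm a - norm b)\<^sup>2"
  proof -
    have t: "t = 1 - s" using assms by simp
    show ?thesis unfolding t by (simp add: power2_eq_square algebra_simps)
  qed
  also have "\<dots> \<le> s * (norm a)\<^sup>2 + t * (norm b)\<^sup>2" using assms by simp
  finally show ?thesis .
qed

text \<open>The set is the image of the unit disc under \<open>z / (1 + B z)\<close>.\<close>

lemma convex_moebius_image:
  assumes "\<bar>B\<bar> \<le> 1"
  shows "convex {s::complex. norm s < norm (1 - of_real B * s)}"
proof -
  \<comment> \<open>Squaring describes the set as a sublevel set of a function that is convex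
    because \<open>1 - B^2\<close> is nonnegative.\<close>
  have iff: "norm s < norm (1 - of_real B * s) \<longleftrightarrow> (1 - B\<^sup>2) * (norm s)\<^sup>2 + 2 * B * Re s < 1"
    for s :: complex
  proof -
    have "norm s < norm (1 - of_real B * s) \<longleftrightarrow> (norm s)\<^sup>2 < (norm (1 - of_real B * s))\<^sup>2"
      by (meson norm_ge_zero power2_less_imp_less power_strict_mono pos2)
    thus ?thesis unfolding cmod_power2 by (simp add: power2_eq_square algebra_simps)
  qed
  show ?thesis
  proof (rule convexI, unfold mem_Collect_eq iff)
    fix a b :: complex and s t :: real
    assume a: "(1 - B\<^sup>2) * (norm a)\<^sup>2 + 2 * B * Re a < 1"
      and b: "(1 - B\<^sup>2) * (norm b)\<^sup>2 + 2 * B * Re b < 1" and st: "0 \<le> s" "0 \<le> t" "s + t = 1"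
    have "1 - B\<^sup>2 \<ge> 0" using assms by (simp add: abs_square_le_1)
    from mult_left_mono[OF norm_sq_convex_comb_le[OF st] this, of a b]
    have "(1 - B\<^sup>2) * (norm (s *\<^sub>R a + t *\<^sub>R b))\<^sup>2 + 2 * B * Re (s *\<^sub>R a + t *\<^sub>R b)
        \<le> s * ((1 - B\<^sup>2) * (norm a)\<^sup>2 + 2 * B * Re a) + t * ((1 - B\<^sup>2) * (norm b)\<^sup>2 + 2 * B * Re b)"
      by (simp add: algebra_simps)
    also have "\<dots> < 1" using convex_bound_lt[OF a b st] .
    finally show "(1 - B\<^sup>2) * (norm (s *\<^sub>R a + t *\<^sub>R b))\<^sup>2 + 2 * B * Re (s *\<^sub>R a + t *\<^sub>R b) < 1" .
  qed
qed

text \<open>With \<open>d = b - a\<close>, the mean value theorem for \<open>Re (cnj d * G)\<close>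
  on the segment from \<open>a\<close> to \<open>b\<close> gives the increment
  \<open>(norm d)^2 * Re (G' u)\<close>, which is positive and so excludes
  \<open>G a = G b\<close>.\<close>

lemma Noshiro_Warschawski:
  assumes "convex S" and der: "\<And>s. s \<in> S \<Longrightarrow> (G has_field_derivative G' s) (at s)"
    and pos: "\<And>s. s \<in> S \<Longrightarrow> Re (G' s) > 0"
  shows "inj_on G S"
proof (rule inj_onI, rule ccontr)
  fix a b assume ab: "a \<in> S" "b \<in> S" "G a = G b" "a \<noteq> b"
  define d where "d = b - a"
  have seg: "u \<in> S" if "u \<in> closed_segment a b" for u
    using that ab closed_segment_subset[OF ab(1,2) \<open>convex S\<close>] by auto
  have "((\<lambda>s. cnj d * G s) has_field_derivative cnj d * G' u) (at u)" if "u \<in> closed_segment a b" for u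
    by (rule DERIV_cmult[OF der[OF seg[OF that]]])
  from complex_mvt_line[OF this] obtain u where u: "u \<in> closed_segment a b"
    "Re (cnj d * G b) - Re (cnj d * G a) = Re (cnj d * G' u * (b - a))" by blast
  hence "Re (G' u * (cnj d * d)) = 0" using ab by (simp add: d_def mult_ac)
  hence "(norm d)\<^sup>2 * Re (G' u) = 0"
    by (simp add: complex_norm_square[symmetric] mult.commute del: of_real_power)
  thus False using pos[OF seg[OF u(1)]] ab by (simp add: d_def)
qed

text \<open>The expression is \<open>T = Q' / (\<gamma> h')\<close>. Differentiating the equation gives
  \<open>T K + z T' = 1\<close> with \<open>Re K > 0\<close>, and at a minimum of \<open>Re T\<close> over a disc \<open>z T'\<close> is real
  and nonpositive.\<close>

lemma Re_euler_solution_deriv_pos: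
  assumes B: "\<bar>B\<bar> \<le> 1" and "A \<noteq> B" and \<gamma>: "Re \<gamma> > 0" and Q: "Q holomorphic_on unit_disc"
    and eq: "\<And>z. z \<in> unit_disc \<Longrightarrow> Q z + z * deriv Q z / \<gamma> = moebius_h A B z"
    and z: "z \<in> unit_disc"
  shows "Re (deriv Q z * (1 + of_real B * z)\<^sup>2 / (\<gamma> * (of_real A - of_real B))) > 0"
proof -
  define c :: complex where "c = \<gamma> * (of_real A - of_real B)"
  have \<gamma>0: "\<gamma> \<noteq> 0" using \<gamma> by auto
  hence c: "c \<noteq> 0" using \<open>A \<noteq> B\<close> by (simp add: c_def)
  define T where "T z = deriv Q z * (1 + of_real B * z)\<^sup>2 / c" for z
  define K where "K z = \<gamma> + (1 - of_real B * z) / (1 + of_real B * z)" for z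
  have Q': "deriv Q holomorphic_on unit_disc" by (intro holomorphic_intros Q) auto
  \<comment> \<open>The quotient is the Cayley transform of \<open>B z\<close>, which maps the disc
    into the right half-plane.\<close>
  have K: "Re (K z) > 0" if "z \<in> unit_disc" for z
  proof -
    have nz: "1 + of_real B * z \<noteq> 0" using one_plus_mult_nonzero[OF B] that by auto
    have "norm (of_real B * z) < 1"
      using that B mult_right_mono[OF B norm_ge_zero[of z]] by (simp add: norm_mult)
    hence "(norm (of_real B * z))\<^sup>2 < 1" by (simp add: abs_square_less_1)
    hence "Re ((1 - of_real B * z) * cnj (1 + of_real B * z)) > 0"
      unfolding cmod_power2 by (simp add: power2_eq_square algebra_simps)
    hence "Re ((1 - of_real B * z) / (1 + of_real B * z)) > 0"
      using nz by (simp add: Re_complex_div_gt_0)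
    thus ?thesis using \<gamma> by (simp add: K_def)
  qed
  have T: "(T has_field_derivative deriv T z) (at z)" "T z * K z + z * deriv T z = 1"
    if z: "z \<in> unit_disc" for z
  proof -
    have nz: "1 + of_real B * z \<noteq> 0" using one_plus_mult_nonzero[OF B] z by auto
    have d: "(Q has_field_derivative deriv Q z) (at z)"
      "(deriv Q has_field_derivative deriv (deriv Q) z) (at z)"
      using Q Q' z by (auto intro: holomorphic_derivI[OF _ open_ball])
    have "((\<lambda>z. Q z + z * deriv Q z / \<gamma>) has_field_derivative
        deriv Q z + (deriv Q z + z * deriv (deriv Q) z) / \<gamma>) (at z)"
      using d \<gamma>0 by (auto intro!: derivative_eq_intros)
    moreover have "((\<lambda>z. Q z + z * deriv Q z / \<gamma>) has_field_derivative
        (of_real A - of_real B) / (1 + of_real B * z)\<^sup>2) (at z)"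
      by (rule has_field_derivative_transform_within_open[OF moebius_h_has_field_derivative[OF nz] open_ball z])
        (use eq in auto)
    ultimately have e: "deriv Q z + (deriv Q z + z * deriv (deriv Q) z) / \<gamma>
        = (of_real A - of_real B) / (1 + of_real B * z)\<^sup>2"
      by (rule DERIV_unique)
    have dT: "(T has_field_derivative (deriv (deriv Q) z * (1 + of_real B * z)\<^sup>2
        + deriv Q z * (2 * (1 + of_real B * z) * of_real B)) / c) (at z)"
      unfolding T_def[abs_def] using d c by (auto intro!: derivative_eq_intros)
    thus "(T has_field_derivative deriv T z) (at z)" by (metis DERIV_imp_deriv)
    \<comment> \<open>In these terms \<open>K z = \<gamma> + (2 - X) / X\<close>, and the claim
      becomes the differentiated equation multiplied by \<open>X^2\<close>.\<close>
    define X Q1 Q2 a where "X = 1 + of_real B * z" and "Q1 = deriv Q z"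
      and "Q2 = deriv (deriv Q) z" and "a = complex_of_real A - of_real B"
    have X: "X \<noteq> 0" using nz by (simp add: X_def)
    have a: "a \<noteq> 0" using \<open>A \<noteq> B\<close> by (simp add: a_def)
    have Bz: "of_real B * z = X - 1" by (simp add: X_def)
    have e': "(\<gamma> * Q1 + Q1 + z * Q2) * X\<^sup>2 = \<gamma> * a"
    proof -
      have "Q1 + (Q1 + z * Q2) / \<gamma> = a / X\<^sup>2"
        using e by (simp add: X_def Q1_def Q2_def a_def)
      thus ?thesis using X \<gamma>0 by (simp add: field_simps)
    qed
    have "T z = Q1 * X\<^sup>2 / c" "K z = \<gamma> + (2 - X) / X"
      by (simp_all add: T_def K_def X_def Q1_def)
    moreover have "deriv T z = (Q2 * X\<^sup>2 + Q1 * (2 * X * of_real B)) / c"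
      using DERIV_imp_deriv[OF dT] by (simp add: X_def Q1_def Q2_def)
    ultimately have "T z * K z + z * deriv T z
      = (Q1 * X\<^sup>2 * (\<gamma> + (2 - X) / X) + z * Q2 * X\<^sup>2 + Q1 * (2 * X * (of_real B * z))) / c"
      by (simp add: add_divide_distrib[symmetric] algebra_simps)
    also have "c = \<gamma> * a" by (simp add: c_def a_def)
    also have "of_real B * z = X - 1" by (rule Bz)
    also have "Q1 * X\<^sup>2 * (\<gamma> + (2 - X) / X) = Q1 * X\<^sup>2 * \<gamma> + Q1 * X * (2 - X)"
      using X by (simp add: field_simps power2_eq_square)
    also have "(Q1 * X\<^sup>2 * \<gamma> + Q1 * X * (2 - X) + z * Q2 * X\<^sup>2 + Q1 * (2 * X * (X - 1)))
      = (\<gamma> * Q1 + Q1 + z * Q2) * X\<^sup>2"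
      by (simp add: power2_eq_square algebra_simps)
    finally show "T z * K z + z * deriv T z = 1" using e' \<gamma>0 a by simp
  qed
  have cont: "continuous_on unit_disc T"
    by (rule continuous_at_imp_continuous_on) (blast intro: DERIV_isCont T(1))
  have ball: "w \<in> unit_disc" if "w \<in> cball 0 (norm z)" for w using that z by auto
  have "continuous_on (cball 0 (norm z)) (\<lambda>w. Re (T w))"
    using ball by (intro continuous_intros continuous_on_subset[OF cont]) auto
  from continuous_attains_inf[OF compact_cball _ this] obtain z0
    where z0: "norm z0 \<le> norm z" "\<And>w. norm w \<le> norm z \<Longrightarrow> Re (T z0) \<le> Re (T w)"
    by auto
  have z0': "z0 \<in> unit_disc" using z0 ball by auto
  define x where "x = - Re (z0 * deriv T z0)"
  have max: "Re (- T w) \<le> Re (- T z0)" if "norm w < norm z0" for w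
    using z0 that by auto
  note mx = deriv_at_max_Re[OF DERIV_minus[OF T(1)[OF z0']] max]
  have x: "x \<ge> 0" "z0 * deriv T z0 = of_real (- x)"
    using mx by (auto simp: x_def complex_eq_iff)
  have "Re (T z0) > 0"
  proof (rule ccontr)
    assume neg: "\<not> ?thesis"
    have "T z0 * K z0 = of_real (1 + x)" using T(2)[OF z0'] x(2) by (simp add: algebra_simps)
    \<comment> \<open>Multiplying by the conjugate of \<open>T z0\<close> and taking real parts
      compares \<open>Re K > 0\<close> with \<open>Re T\<close>. A nonpositive \<open>Re T\<close>
      forces \<open>T z0 = 0\<close>, against \<open>T z0 * K z0 = 1 + x\<close>.\<close>
    hence "cnj (T z0) * T z0 * K z0 = of_real (1 + x) * cnj (T z0)"
      by (simp add: mult.assoc)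
    hence "Re (of_real ((norm (T z0))\<^sup>2) * K z0) = Re (of_real (1 + x) * cnj (T z0))"
      by (simp only: complex_norm_square mult.commute[of "cnj (T z0)" "T z0"])
    hence e: "(norm (T z0))\<^sup>2 * Re (K z0) = (1 + x) * Re (T z0)"
      by (simp del: of_real_power of_real_add)
    have "(1 + x) * Re (T z0) \<le> 0" using neg x by (simp add: mult_nonneg_nonpos)
    hence "(norm (T z0))\<^sup>2 * Re (K z0) \<le> 0" using e by simp
    hence "T z0 = 0" using K[OF z0'] by (simp add: mult_le_0_iff)
    hence "of_real (1 + x) = (0::complex)"
      using \<open>T z0 * K z0 = of_real (1 + x)\<close> by simp
    thus False using x(1) unfolding of_real_eq_0_iff by simp
  qed
  hence "Re (T z) > 0" using z0(2)[of z] by simp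
  thus ?thesis by (simp add: T_def c_def)
qed

text \<open>The map \<open>\<sigma>\<close> inverts \<open>z / (1 + B z)\<close>, and
  \<open>Q (\<sigma> s) / c\<close> has the derivative \<open>T (\<sigma> s)\<close>, whose real
  part is positive. Its domain \<open>S\<close> is convex, so \<open>Noshiro_Warschawski\<close>
  applies, and \<open>\<sigma>\<close> maps \<open>S\<close> onto the disc.\<close>

lemma euler_solution_inj_on:
  assumes B: "\<bar>B\<bar> \<le> 1" and "A \<noteq> B" and \<gamma>: "Re \<gamma> > 0" and Q: "Q holomorphic_on unit_disc"
    and eq: "\<And>z. z \<in> unit_disc \<Longrightarrow> Q z + z * deriv Q z / \<gamma> = moebius_h A B z"
  shows "inj_on Q unit_disc"
proof -
  define S where "S = {s::complex. norm s < norm (1 - of_real B * s)}"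
  define \<sigma> where "\<sigma> s = s / (1 - of_real B * s)" for s :: complex
  define c :: complex where "c = \<gamma> * (of_real A - of_real B)"
  have c: "c \<noteq> 0" using \<open>A \<noteq> B\<close> \<gamma> by (auto simp: c_def)
  define T where "T z = deriv Q z * (1 + of_real B * z)\<^sup>2 / c" for z
  have \<sigma>: "\<sigma> s \<in> unit_disc" and nz: "1 - of_real B * s \<noteq> 0" if "s \<in> S" for s
    using that by (auto simp: S_def \<sigma>_def norm_divide divide_less_eq_1)
  have "inj_on (\<lambda>s. Q (\<sigma> s) / c) S"
  proof (rule Noshiro_Warschawski)
    show "convex S" unfolding S_def by (rule convex_moebius_image[OF B])
    show "Re (T (\<sigma> s)) > 0" if "s \<in> S" for s
      using Re_euler_solution_deriv_pos[OF B \<open>A \<noteq> B\<close> \<gamma> Q eq \<sigma>[OF that]] by (simp add: T_def c_def)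
    show "((\<lambda>s. Q (\<sigma> s) / c) has_field_derivative T (\<sigma> s)) (at s)" if s: "s \<in> S" for s
    proof -
      have "(\<sigma> has_field_derivative 1 / (1 - of_real B * s)\<^sup>2) (at s)"
        unfolding \<sigma>_def[abs_def] using nz[OF s]
        by (auto intro!: derivative_eq_intros simp: field_simps power2_eq_square)
      moreover have "(Q has_field_derivative deriv Q (\<sigma> s)) (at (\<sigma> s))"
        using Q \<sigma>[OF s] by (rule holomorphic_derivI[OF _ open_ball])
      ultimately have "((\<lambda>s. Q (\<sigma> s) / c) has_field_derivative
          deriv Q (\<sigma> s) * (1 / (1 - of_real B * s)\<^sup>2) / c) (at s)"
        by (intro DERIV_cdivide DERIV_chain2[of Q])
      moreover have "1 + of_real B * \<sigma> s = 1 / (1 - of_real B * s)"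
        using nz[OF s] by (simp add: \<sigma>_def field_simps)
      ultimately show ?thesis by (simp add: T_def power_divide)
    qed
  qed
  moreover have "\<exists>s\<in>S. \<sigma> s = z" if "z \<in> unit_disc" for z
  proof
    have nz: "1 + of_real B * z \<noteq> 0" using one_plus_mult_nonzero[OF B] that by auto
    have *: "1 - of_real B * (z / (1 + of_real B * z)) = 1 / (1 + of_real B * z)"
      using nz by (simp add: field_simps)
    show "\<sigma> (z / (1 + of_real B * z)) = z" unfolding \<sigma>_def * using nz by simp
    show "z / (1 + of_real B * z) \<in> S"
      unfolding S_def mem_Collect_eq * using nz that by (simp add: norm_divide divide_strict_right_mono)
  qed
  ultimately show ?thesis
    unfolding inj_on_def by metis
qed

subsection \<open>Jack's lemma\<close>

text \<open>Dividing by \<open>z ^ n\<close> costs a factor \<open>1 / r ^ n\<close> on the circle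
  of radius \<open>r\<close>. The maximum principle carries the bound inside, and \<open>r\<close>
  tends to 1.\<close>

lemma Schwarz_order:
  assumes W1: "W1 holomorphic_on unit_disc"
    and W: "\<And>z. z \<in> unit_disc \<Longrightarrow> norm (z ^ n * W1 z) \<le> 1"
    and z: "z \<in> unit_disc"
  shows "norm (W1 z) \<le> 1"
proof -
  have le: "r ^ n * norm (W1 z) \<le> 1" if r: "r \<in> {norm z<..<1}" for r
  proof -
    have r0: "0 < r" "r < 1" using r by (auto intro: le_less_trans[OF norm_ge_zero])
    have sub: "cball 0 r \<subseteq> (unit_disc :: complex set)" using r by auto
    have "norm (W1 z) \<le> 1 / r ^ n"
    proof (rule maximum_modulus_frontier[of W1 "cball 0 r"])
      show "W1 holomorphic_on interior (cball 0 r)"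
        using r0 by (intro holomorphic_on_subset[OF W1]) auto
      show "continuous_on (closure (cball 0 r)) W1"
        using sub by (auto intro!: holomorphic_on_imp_continuous_on intro: holomorphic_on_subset[OF W1])
      show "norm (W1 w) \<le> 1 / r ^ n" if "w \<in> frontier (cball 0 r)" for w
        using W[of w] that r0 by (simp add: norm_mult norm_power field_simps)
    qed (use r in auto)
    thus ?thesis using r0 by (simp add: field_simps)
  qed
  have "((\<lambda>r. r ^ n * norm (W1 z)) \<longlongrightarrow> 1 ^ n * norm (W1 z)) (at_left 1)"
    by (intro tendsto_intros)
  moreover have "\<forall>\<^sub>F r in at_left 1. r ^ n * norm (W1 z) \<le> 1"
    using eventually_at_left_real[of "norm z" 1] z by (auto elim!: eventually_mono simp: le)
  ultimately have "1 ^ n * norm (W1 z) \<le> 1"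
    by (rule tendsto_upperbound) auto
  thus ?thesis by simp
qed

text \<open>The factor \<open>z ^ n\<close> contributes \<open>n\<close> to the logarithmic derivative; the contribution of \<open>\<phi>\<close>
  is real and nonnegative at a maximum of \<open>norm \<phi>\<close>.\<close>

lemma Jack_order:
  fixes \<phi> :: "complex \<Rightarrow> complex"
  assumes \<phi>: "(\<phi> has_field_derivative D) (at z0)" and "\<phi> z0 \<noteq> 0"
    and max: "\<And>z. norm z < norm z0 \<Longrightarrow> norm (\<phi> z) \<le> norm (\<phi> z0)"
  shows "\<exists>m::real. m \<ge> of_nat n \<and>
    (\<exists>d. ((\<lambda>z. z ^ n * \<phi> z) has_field_derivative d) (at z0) \<and> z0 * d = of_real m * (z0 ^ n * \<phi> z0))"
proof -
  have d: "((\<lambda>z. \<phi> z / \<phi> z0) has_field_derivative D / \<phi> z0) (at z0)"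
    using \<phi> by (rule DERIV_cdivide)
  have max': "Re (\<phi> z / \<phi> z0) \<le> Re (\<phi> z0 / \<phi> z0)" if "norm z < norm z0" for z
  proof -
    have "Re (\<phi> z / \<phi> z0) \<le> norm (\<phi> z / \<phi> z0)" by (rule complex_Re_le_cmod)
    also have "\<dots> \<le> 1" using max[OF that] \<open>\<phi> z0 \<noteq> 0\<close> by (simp add: norm_divide divide_le_eq)
    finally show ?thesis using \<open>\<phi> z0 \<noteq> 0\<close> by simp
  qed
  define x where "x = Re (z0 * (D / \<phi> z0))"
  have x: "x \<ge> 0" "z0 * (D / \<phi> z0) = of_real x"
    using deriv_at_max_Re[OF d max'] by (auto simp: x_def complex_eq_iff)
  hence D: "z0 * D = of_real x * \<phi> z0" using \<open>\<phi> z0 \<noteq> 0\<close> by (simp add: field_simps)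
  have "((\<lambda>z. z ^ n * \<phi> z) has_field_derivative of_nat n * z0 ^ (n - 1) * \<phi> z0 + z0 ^ n * D) (at z0)"
    using \<phi> by (auto intro!: derivative_eq_intros)
  moreover have "z0 * (of_nat n * z0 ^ (n - 1) * \<phi> z0 + z0 ^ n * D) = of_real (n + x) * (z0 ^ n * \<phi> z0)"
  proof -
    have "z0 * (of_nat n * z0 ^ (n - 1) * \<phi> z0 + z0 ^ n * D)
        = of_nat n * (z0 * z0 ^ (n - 1)) * \<phi> z0 + z0 ^ n * (z0 * D)"
      by (simp add: algebra_simps)
    also have "of_nat n * (z0 * z0 ^ (n - 1)) = of_nat n * z0 ^ n" by (cases n) auto
    finally show ?thesis unfolding D by (simp add: algebra_simps)
  qed
  ultimately show ?thesis using x(1) by (intro exI[of _ "n + x"]) auto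
qed

text \<open>The hypothesis \<open>key\<close> excludes that a point \<open>P z\<close> is reached by \<open>\<Psi>\<close> too far from the
  origin whenever \<open>P\<close> and \<open>\<Psi>\<close> touch there as in Jack's lemma.
  Writing \<open>w = inv \<Psi> \<circ> P = z ^ n * \<phi>\<close>, this gives \<open>norm \<phi> \<le> 1\<close> on every disc that \<open>P\<close> maps
  into the image of \<open>\<Psi>\<close>, and the bound \<open>norm (w z) \<le> norm z ^ n\<close> allows to enlarge any such
  disc up to the unit disc.\<close>

lemma Jack_subordination:
  fixes \<Psi> P p :: "complex \<Rightarrow> complex"
  assumes \<Psi>: "\<Psi> holomorphic_on unit_disc" "inj_on \<Psi> unit_disc"
    and p: "p holomorphic_on unit_disc" and P: "\<And>z. z \<in> unit_disc \<Longrightarrow> P z = \<Psi> 0 + z ^ n * p z"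
    and n: "n \<ge> 1"
    and key: "\<And>z \<zeta> m. z \<in> unit_disc \<Longrightarrow> \<zeta> \<in> unit_disc \<Longrightarrow> m \<ge> of_nat n \<Longrightarrow> P z = \<Psi> \<zeta> \<Longrightarrow>
      z * deriv P z = of_real m * (\<zeta> * deriv \<Psi> \<zeta>) \<Longrightarrow> norm \<zeta> \<le> norm z ^ n"
  shows "P \<prec>\<prec> \<Psi>"
proof -
  define D where "D = \<Psi> ` unit_disc"
  obtain g where g: "g holomorphic_on D" "\<And>z. z \<in> unit_disc \<Longrightarrow> g (\<Psi> z) = z"
    using holomorphic_has_inverse[OF \<Psi>(1) open_ball \<Psi>(2)] unfolding D_def by metis
  have "open D" unfolding D_def by (rule open_mapping_thm3[OF \<Psi>(1) open_ball \<Psi>(2)])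
  have gD: "g y \<in> unit_disc" "\<Psi> (g y) = y" if "y \<in> D" for y
    using that g(2) by (auto simp: D_def)
  have \<Psi>0: "\<Psi> 0 \<in> D" "g (\<Psi> 0) = 0" using g(2)[of 0] by (auto simp: D_def)
  have holP: "P holomorphic_on unit_disc"
    by (rule holomorphic_transform[of "\<lambda>z. \<Psi> 0 + z ^ n * p z"])
      (use P p in \<open>auto intro!: holomorphic_intros\<close>)
  have P0: "P 0 = \<Psi> 0" using P[of 0] n by simp
  \<comment> \<open>The difference quotient of \<open>g\<close> at \<open>\<Psi> 0\<close> with its
    removable singularity filled. It makes \<open>\<phi>\<close> the quotient of
    \<open>g (P z)\<close> by \<open>z ^ n\<close> without a division at 0.\<close>
  define \<kappa> where "\<kappa> y = (if y = \<Psi> 0 then deriv g (\<Psi> 0) else (g y - g (\<Psi> 0)) / (y - \<Psi> 0))" for y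
  have \<kappa>: "\<kappa> holomorphic_on D" unfolding \<kappa>_def[abs_def]
    using g(1) \<Psi>0 \<open>open D\<close> by (intro pole_lemma) (auto simp: interior_open)
  have g\<kappa>: "g y = (y - \<Psi> 0) * \<kappa> y" for y using \<Psi>0 by (auto simp: \<kappa>_def)
  define \<phi> where "\<phi> z = p z * \<kappa> (P z)" for z
  have w: "g (P z) = z ^ n * \<phi> z" if "z \<in> unit_disc" for z
    using g\<kappa>[of "P z"] P[OF that] by (simp add: \<phi>_def)
  have bound: "norm (\<phi> z) \<le> 1" if R: "R \<le> 1" "P ` ball 0 R \<subseteq> D" and z: "z \<in> ball 0 R" for z R
  proof -
    have sub: "ball 0 R \<subseteq> (unit_disc :: complex set)" using R by auto
    have \<phi>: "\<phi> holomorphic_on ball 0 R"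
    proof -
      have "(\<lambda>z. \<kappa> (P z)) holomorphic_on ball 0 R"
        using holomorphic_on_compose_gen[OF holomorphic_on_subset[OF holP sub] \<kappa>] R(2)
        by (auto simp: o_def)
      thus ?thesis unfolding \<phi>_def[abs_def]
        by (intro holomorphic_intros holomorphic_on_subset[OF p sub])
    qed
    \<comment> \<open>The closed disc of this radius contains \<open>z\<close> and lies where
      \<open>\<phi>\<close> is holomorphic, so a maximum point \<open>z0\<close> on its circle
      dominates \<open>\<phi> z\<close>.\<close>
    define s where "s = (norm z + R) / 2"
    have s: "norm z < s" "s < R" using z by (auto simp: s_def)
    have s0: "0 < s" using s(1) norm_ge_zero[of z] by linarith
    have subs: "cball 0 s \<subseteq> (ball 0 R :: complex set)" using s by auto
    have cont: "continuous_on (cball 0 s) \<phi>"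
      by (rule holomorphic_on_imp_continuous_on[OF holomorphic_on_subset[OF \<phi> subs]])
    have "continuous_on (sphere 0 s) (\<lambda>z. norm (\<phi> z))"
      by (intro continuous_intros continuous_on_subset[OF cont]) auto
    moreover have "sphere (0::complex) s \<noteq> {}" using s0 by simp
    ultimately obtain z0 where z0: "z0 \<in> sphere 0 s"
      "\<And>w. w \<in> sphere 0 s \<Longrightarrow> norm (\<phi> w) \<le> norm (\<phi> z0)"
      using continuous_attains_sup[OF compact_sphere] by metis
    have max: "norm (\<phi> w) \<le> norm (\<phi> z0)" if "norm w \<le> s" for w
    proof (rule maximum_modulus_frontier[of \<phi> "cball 0 s"])
      show "\<phi> holomorphic_on interior (cball 0 s)"
        using s by (intro holomorphic_on_subset[OF \<phi>]) auto
    qed (use that z0 cont in auto)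
    have "norm (\<phi> z0) \<le> 1"
    proof (cases "\<phi> z0 = 0")
      case False
      have z0R: "z0 \<in> ball 0 R" "z0 \<in> unit_disc" using z0(1) s R(1) by auto
      have "(\<phi> has_field_derivative deriv \<phi> z0) (at z0)"
        by (rule holomorphic_derivI[OF \<phi> open_ball z0R(1)])
      from Jack_order[OF this False, of n] max z0(1) obtain m d where m: "m \<ge> of_nat n"
        and d: "((\<lambda>z. z ^ n * \<phi> z) has_field_derivative d) (at z0)"
        "z0 * d = of_real m * (z0 ^ n * \<phi> z0)"
        by auto
      define \<zeta> where "\<zeta> = g (P z0)"
      have \<zeta>: "\<zeta> = z0 ^ n * \<phi> z0" using w[OF z0R(2)] by (simp add: \<zeta>_def)
      have PD: "P z0 \<in> D" using R(2) z0R by auto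
      have \<zeta>U: "\<zeta> \<in> unit_disc" "\<Psi> \<zeta> = P z0" using gD[OF PD] by (auto simp: \<zeta>_def)
      have "(\<Psi> has_field_derivative deriv \<Psi> \<zeta>) (at (z0 ^ n * \<phi> z0))"
        using holomorphic_derivI[OF \<Psi>(1) open_ball \<zeta>U(1)] \<zeta> by simp
      from DERIV_chain2[OF this d(1)]
      have "((\<lambda>z. \<Psi> (z ^ n * \<phi> z)) has_field_derivative deriv \<Psi> \<zeta> * d) (at z0)" .
      hence "(P has_field_derivative deriv \<Psi> \<zeta> * d) (at z0)"
      proof (rule has_field_derivative_transform_within_open[OF _ open_ball z0R(1)])
        fix z :: complex assume z: "z \<in> ball 0 R"
        hence "P z \<in> D" using R(2) by auto
        from gD(2)[OF this] show "\<Psi> (z ^ n * \<phi> z) = P z" using w[of z] z sub by auto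
      qed
      hence "deriv P z0 = deriv \<Psi> \<zeta> * d" by (rule DERIV_imp_deriv)
      \<comment> \<open>The chain rule turns Jack's relation \<open>z0 * d = m * \<zeta>\<close> for
        \<open>g (P z)\<close> into the touching condition of \<open>key\<close>.\<close>
      hence "z0 * deriv P z0 = of_real m * (\<zeta> * deriv \<Psi> \<zeta>)"
        using d(2) \<zeta> by (simp add: algebra_simps)
      from key[OF z0R(2) \<zeta>U(1) m \<zeta>U(2)[symmetric] this]
      have "s ^ n * norm (\<phi> z0) \<le> s ^ n * 1"
        using z0(1) by (simp add: \<zeta> norm_mult norm_power)
      thus ?thesis using s0 by (simp add: mult_le_cancel_left_pos)
    qed auto
    thus ?thesis using max[of z] s(1) by simp
  qed
  have "P z \<in> D" if z: "z \<in> unit_disc" for z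
  proof (rule ccontr)
    assume "P z \<notin> D"
    have sub: "cball 0 (norm z) \<subseteq> (unit_disc :: complex set)" using z by auto
    have cont: "continuous_on (cball 0 (norm z)) P"
      by (rule holomorphic_on_imp_continuous_on[OF holomorphic_on_subset[OF holP sub]])
    \<comment> \<open>The points that \<open>P\<close> sends outside \<open>D\<close>. The one
      nearest to the origin bounds a ball that \<open>P\<close> still maps into
      \<open>D\<close>.\<close>
    define N where "N = cball 0 (norm z) \<inter> P -` (- D)"
    have "closed N" unfolding N_def
      using cont \<open>open D\<close> by (intro continuous_closed_preimage) auto
    moreover have "N \<noteq> {}" using \<open>P z \<notin> D\<close> by (auto simp: N_def)
    ultimately obtain z1 where z1: "z1 \<in> N" "\<And>w. w \<in> N \<Longrightarrow> dist 0 z1 \<le> dist 0 w"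
      using distance_attains_inf[of N 0] by blast
    define R where "R = norm z1"
    have R: "R < 1" "P z1 \<notin> D" using z1(1) z by (auto simp: N_def R_def)
    hence "z1 \<noteq> 0" using P0 \<Psi>0 by auto
    hence R0: "R > 0" by (simp add: R_def)
    have good: "P ` ball 0 R \<subseteq> D"
    proof (rule image_subsetI, rule ccontr)
      fix u :: complex assume u: "u \<in> ball 0 R" "P u \<notin> D"
      hence "u \<in> N" using z1(1) by (auto simp: N_def R_def)
      from z1(2)[OF this] u(1) show False by (simp add: R_def)
    qed
    \<comment> \<open>The bound on \<open>\<phi>\<close> keeps \<open>P\<close> within a compact
      subset of \<open>D\<close>. By continuity \<open>P z1\<close> lies in it as well, which
      contradicts the choice of \<open>z1\<close>.\<close>
    have "P ` ball 0 R \<subseteq> \<Psi> ` cball 0 (R ^ n)"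
    proof (rule image_subsetI)
      fix u :: complex assume u: "u \<in> ball 0 R"
      hence uU: "u \<in> unit_disc" using R by auto
      have "norm (g (P u)) \<le> norm u ^ n * 1"
        unfolding w[OF uU] norm_mult norm_power
        using bound[OF _ good u] R by (intro mult_left_mono) auto
      also have "\<dots> \<le> R ^ n" using u by (auto intro: power_mono)
      finally have "g (P u) \<in> cball 0 (R ^ n)" by simp
      moreover have "P u = \<Psi> (g (P u))" using gD good u by (metis image_subset_iff)
      ultimately show "P u \<in> \<Psi> ` cball 0 (R ^ n)" by (metis imageI)
    qed
    moreover have Rn: "cball 0 (R ^ n) \<subseteq> (unit_disc :: complex set)"
    proof -
      have "R ^ n < 1" using R R0 n by (simp add: power_less_one_iff)
      thus ?thesis by auto
    qed
    have "closed (\<Psi> ` cball 0 (R ^ n))"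
      by (intro compact_imp_closed compact_continuous_image compact_cball
          holomorphic_on_imp_continuous_on holomorphic_on_subset[OF \<Psi>(1) Rn])
    moreover have "P ` closure (ball 0 R) \<subseteq> closure (P ` ball 0 R)"
    proof (rule image_closure_subset)
      have "R \<le> norm z" using z1(1) by (simp add: N_def R_def)
      hence "closure (ball 0 R) \<subseteq> cball (0::complex) (norm z)" using R0 by auto
      thus "continuous_on (closure (ball 0 R)) P" by (rule continuous_on_subset[OF cont])
    qed (auto simp: closure_subset [THEN subsetD])
    moreover have "z1 \<in> closure (ball 0 R)" using R0 by (simp add: R_def)
    ultimately have "P z1 \<in> \<Psi> ` cball 0 (R ^ n)"
      by (meson closure_minimal image_eqI subset_iff)
    thus False using R(2) Rn by (auto simp: D_def)
  qed
  hence PD: "P ` unit_disc \<subseteq> D" by auto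
  show ?thesis unfolding subordinate_def
  proof (intro conjI holP \<Psi>(1) exI[of _ "\<lambda>z. g (P z)"] ballI)
    show "(\<lambda>z. g (P z)) holomorphic_on unit_disc"
      using holomorphic_on_compose_gen[OF holP g(1) PD] by (simp add: o_def)
    show "g (P 0) = 0" using P0 \<Psi>0 by simp
    fix z :: complex assume "z \<in> unit_disc"
    hence "P z \<in> D" using PD by auto
    thus "norm (g (P z)) < 1" "P z = \<Psi> (g (P z))" using gD by auto
  qed
qed

subsection \<open>The principal power\<close>

text \<open>The series starting at index \<open>n\<close> supplies \<open>g\<close>. The factor has
  no zero because the origin alone accounts for \<open>p\<close> zeros of \<open>f\<close>, and a
  further one would exceed the bound in \<open>p_valent\<close>.\<close>

lemma class_A_factor:
  assumes f: "f \<in> class_A p n" and n: "n \<ge> 1" and p: "p \<ge> 1"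
  obtains g where "g holomorphic_on unit_disc"
    "\<And>z. z \<in> unit_disc \<Longrightarrow> f z = z ^ p * (1 + z ^ n * g z)"
    "\<And>z. z \<in> unit_disc \<Longrightarrow> 1 + z ^ n * g z \<noteq> 0"
proof -
  from f obtain a where holf: "f holomorphic_on unit_disc" and val: "p_valent p f"
    and a: "\<And>z. z \<in> unit_disc \<Longrightarrow>
      ((\<lambda>k. a (k + p) * z ^ (k + p)) has_sum (f z - z ^ p)) {n..}"
    unfolding class_A_def by blast
  define b where "b j = a (j + n + p)" for j
  have sums: "(\<lambda>j. z ^ (n + p) * (b j * z ^ j)) sums (f z - z ^ p)" if "z \<in> unit_disc" for z
  proof -
    have "(\<lambda>j. j + n) ` UNIV = {n..}"
      by (auto simp: image_iff) (metis le_add_diff_inverse2)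
    hence "((\<lambda>k. a (k + p) * z ^ (k + p)) has_sum (f z - z ^ p)) ((\<lambda>j. j + n) ` UNIV)"
      using a[OF that] by simp
    hence "(((\<lambda>k. a (k + p) * z ^ (k + p)) \<circ> (\<lambda>j. j + n)) has_sum (f z - z ^ p)) UNIV"
      by (subst (asm) has_sum_reindex) auto
    from has_sum_imp_sums[OF this] show ?thesis
      by (simp add: o_def b_def power_add mult_ac)
  qed
  define g where "g z = (\<Sum>j. b j * z ^ j)" for z
  have sg: "(\<lambda>j. b j * z ^ j) sums g z" if z: "z \<in> unit_disc" for z
  proof (cases "z = 0")
    case True
    thus ?thesis using powser_sums_zero[of b] by (simp add: g_def sums_iff)
  next
    case False
    have "(\<lambda>j. z ^ (n + p) * (b j * z ^ j) / z ^ (n + p)) sums ((f z - z ^ p) / z ^ (n + p))"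
      by (intro sums_divide sums z)
    hence "summable (\<lambda>j. b j * z ^ j)" using False by (simp add: sums_iff)
    thus ?thesis by (simp add: g_def summable_sums)
  qed
  have holg: "g holomorphic_on unit_disc"
    by (rule power_series_holomorphic[where a = b]) (use sg in auto)
  define k where "k z = 1 + z ^ n * g z" for z
  have k: "k holomorphic_on unit_disc" unfolding k_def[abs_def] by (intro holomorphic_intros holg)
  have fk: "f z = z ^ p * k z" if "z \<in> unit_disc" for z
    using sums_unique2[OF sums[OF that] sums_mult[OF sg[OF that]]]
    by (simp add: k_def power_add algebra_simps)
  have k0: "k 0 = 1" using n by (simp add: k_def)
  have "k z1 \<noteq> 0" if z1: "z1 \<in> unit_disc" for z1
  proof
    assume "k z1 = 0"
    hence z10: "z1 \<noteq> 0" using k0 by auto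
    define S where "S = {z \<in> unit_disc. f z = 0}"
    have fin: "finite S" and le: "value_count f 0 \<le> int p"
      using val by (auto simp: p_valent_def S_def)
    \<comment> \<open>A point where \<open>f\<close> does not vanish shows that the zeros are
      isolated, so that their orders are positive.\<close>
    have "infinite (unit_disc :: complex set)" by (simp add: uncountable_infinite uncountable_ball)
    then obtain u where u: "u \<in> unit_disc" "f u \<noteq> 0"
      using finite_subset[of unit_disc S] fin by (auto simp: S_def subset_iff)
    have pos: "zorder f z > 0" if "z \<in> S" for z
    proof -
      have z: "z \<in> unit_disc" "f z = 0" using that by (auto simp: S_def)
      have "\<forall>\<^sub>F w in at z. f w \<noteq> 0 \<and> w \<in> unit_disc"
        by (rule non_zero_neighbour_alt[OF holf _ _ z(1) u]) auto
      hence "\<exists>\<^sub>F w in at z. f w \<noteq> 0"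
        by (intro eventually_frequently) (auto elim: eventually_mono)
      from zorder_pos_iff[OF holf open_ball z(1) this] show ?thesis using z by simp
    qed
    have "zorder f 0 = int p"
      by (rule zorder_eqI[of unit_disc 0 k]) (use k k0 fk in auto)
    moreover have "0 \<in> S" "z1 \<in> S" using z1 fk[OF z1] fk[of 0] p \<open>k z1 = 0\<close> by (auto simp: S_def)
    moreover have "(\<Sum>z\<in>{0, z1}. zorder f z) \<le> (\<Sum>z\<in>S. zorder f z)"
      using calculation pos by (intro sum_mono2 fin) (auto intro: less_imp_le)
    moreover have "value_count f 0 = (\<Sum>z\<in>S. zorder f z)"
      by (simp add: value_count_def S_def)
    ultimately show False using le pos[of z1] z10 by simp
  qed
  thus ?thesis using that[OF holg] fk by (simp add: k_def)
qed

text \<open>At a zero of the factor \<open>M\<close> the continuity of \<open>powr\<close> from the upper half plane is used, which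
  is reached by \<open>exp \<circ> l\<close> because it has nonzero derivative there.\<close>

lemma powr_eq_holomorphic_branch:
  fixes l M :: "complex \<Rightarrow> complex"
  assumes l: "l holomorphic_on unit_disc" "l 0 = 0"
    and M: "M holomorphic_on unit_disc" "M 0 \<noteq> 0"
    and hol: "(\<lambda>z. exp (l z) powr c * M z) holomorphic_on unit_disc"
    and nz: "\<And>z. z \<in> unit_disc \<Longrightarrow> M z = 0 \<Longrightarrow> deriv l z \<noteq> 0"
    and z: "z \<in> unit_disc"
  shows "exp (l z) powr c = exp (c * l z)"
proof -
  define E where "E z = exp (c * l z)" for z
  define P where "P z = exp (l z) powr c" for z
  have isl: "isCont l z" if "z \<in> unit_disc" for z
    using holomorphic_derivI[OF l(1) open_ball that] by (rule DERIV_isCont)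
  have isE: "isCont E z" if "z \<in> unit_disc" for z
    unfolding E_def using isl[OF that] by (intro continuous_intros)
  have "E holomorphic_on unit_disc" unfolding E_def[abs_def] by (intro holomorphic_intros l)
  hence EM: "(\<lambda>z. E z * M z) holomorphic_on unit_disc" by (intro holomorphic_intros M)
  \<comment> \<open>Close to 0 the imaginary part of \<open>l\<close> stays between
    \<open>- pi\<close> and \<open>pi\<close>, where \<open>Ln (exp (l z)) = l z\<close>.\<close>
  have "\<forall>\<^sub>F z in nhds 0. norm (l z) < pi"
  proof -
    have "((\<lambda>z. norm (l z)) \<longlongrightarrow> norm (l 0)) (nhds 0)"
      using isl[of 0] by (intro tendsto_norm) (simp add: isCont_def tendsto_at_iff_tendsto_nhds)
    thus ?thesis by (rule order_tendstoD) (use l in auto)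
  qed
  then obtain e where e: "e > 0" "\<And>z. dist z 0 < e \<Longrightarrow> norm (l z) < pi"
    unfolding eventually_nhds_metric by auto
  have near: "P z = E z" if "z \<in> ball 0 (min e 1)" for z
  proof -
    have "\<bar>Im (l z)\<bar> < pi" using e(2)[of z] that abs_Im_le_cmod[of "l z"] by simp
    thus ?thesis by (simp add: P_def E_def powr_def Ln_exp)
  qed
  \<comment> \<open>Only the product with \<open>M\<close> is known to be holomorphic, so the
    identity theorem is applied to the products.\<close>
  have eq: "P z * M z = E z * M z" if z: "z \<in> unit_disc" for z
    by (rule analytic_continuation_open[of "ball 0 (min e 1)" unit_disc
          "\<lambda>z. P z * M z" "\<lambda>z. E z * M z"])
      (use e EM z near hol in \<open>auto simp: P_def\<close>)
  show ?thesis
  proof (cases "M z = 0")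
    case False
    thus ?thesis using eq[OF z] by (simp add: P_def E_def)
  next
    case True
    define d where "d = deriv l z * exp (l z)"
    have d: "d \<noteq> 0" using nz[OF z True] by (simp add: d_def)
    \<comment> \<open>In this direction \<open>exp (l z)\<close> has derivative \<open>\<i>\<close>,
      so a path starting on the negative axis enters the upper half-plane.\<close>
    define v where "v = \<i> / d"
    have lim: "filterlim (\<lambda>t::real. z + of_real t * v) (at z) (at_right 0)"
    proof (rule filterlim_atI)
      have "((\<lambda>t::real. z + of_real t * v) \<longlongrightarrow> z + of_real 0 * v) (at_right 0)"
        by (intro tendsto_intros)
      thus "((\<lambda>t::real. z + of_real t * v) \<longlongrightarrow> z) (at_right 0)" by simp
      show "\<forall>\<^sub>F t::real in at_right 0. z + of_real t * v \<noteq> z"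
        using eventually_at_right_less[of 0] by eventually_elim (use d in \<open>auto simp: v_def\<close>)
    qed
    have "\<exists>C. isCont C z \<and> C z = P z \<and> (\<forall>\<^sub>F t::real in at_right 0. C (z + of_real t * v) = P (z + of_real t * v))"
    proof (cases "exp (l z) \<in> \<real>\<^sub>\<le>\<^sub>0")
      case False
      have "isCont P z" unfolding P_def using isl[OF z] False by (intro continuous_intros) auto
      thus ?thesis by (intro exI[of _ P]) auto
    next
      case neg: True
      \<comment> \<open>The power with the cut of the logarithm turned to the negative imaginary
        axis. It is continuous at negative reals and equals the principal power for nonnegative
        imaginary part.\<close>
      define C where "C w = exp (c * (Ln (- \<i> * exp (l w)) + \<i> * of_real pi / 2))" for w
      have CP: "C w = P w" if "Im (exp (l w)) \<ge> 0" for w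
        using Ln_times_ii[of "- \<i> * exp (l w)"] that
        by (simp add: C_def P_def powr_def mult.assoc[symmetric])
      have im: "Im (exp (l z)) = 0" "Re (exp (l z)) < 0"
      proof -
        show "Im (exp (l z)) = 0" using neg by (simp add: complex_nonpos_Reals_iff)
        moreover have "Re (exp (l z)) \<le> 0" using neg by (simp add: complex_nonpos_Reals_iff)
        ultimately show "Re (exp (l z)) < 0"
          using exp_not_eq_zero[of "l z"] unfolding complex_eq_iff by (auto simp del: exp_not_eq_zero)
      qed
      have "- \<i> * exp (l z) \<notin> \<real>\<^sub>\<le>\<^sub>0"
        using im by (simp add: complex_nonpos_Reals_iff)
      hence "isCont C z" unfolding C_def using isl[OF z]
        by (intro continuous_intros) auto
      moreover have "((\<lambda>w. - \<i> * exp (l w)) has_field_derivative - \<i> * d) (at z)"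
        using holomorphic_derivI[OF l(1) open_ball z]
        by (auto intro!: derivative_eq_intros simp: d_def)
      from has_real_derivative_ray[OF this, of v]
      have "((\<lambda>t. Im (exp (l (z + of_real t * v)))) has_real_derivative 1) (at 0)"
        using d by (simp add: v_def)
      from has_real_derivative_pos_inc_right[OF this] obtain \<delta> where "\<delta> > 0"
        "\<And>h. h > 0 \<Longrightarrow> h < \<delta> \<Longrightarrow> 0 < Im (exp (l (z + of_real h * v)))"
        using im by auto
      hence "\<forall>\<^sub>F t::real in at_right 0. C (z + of_real t * v) = P (z + of_real t * v)"
        unfolding eventually_at_right_field by (meson CP less_imp_le)
      ultimately show ?thesis using CP[of z] im by (intro exI[of _ C]) auto
    qed
    then obtain C where C: "isCont C z" "C z = P z"
      "\<forall>\<^sub>F t::real in at_right 0. C (z + of_real t * v) = P (z + of_real t * v)" by blast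
    \<comment> \<open>Since \<open>M 0\<close> is not 0, the zeros of \<open>M\<close> are isolated,
      and \<open>P = E\<close> holds on a punctured neighbourhood of \<open>z\<close>.\<close>
    have "\<forall>\<^sub>F w in at z. M w \<noteq> 0 \<and> w \<in> unit_disc"
      by (rule non_zero_neighbour_alt[OF M(1) _ _ z _ M(2)]) auto
    hence "\<forall>\<^sub>F w in at z. P w = E w"
      by eventually_elim (use eq in auto)
    from eventually_compose_filterlim[OF this lim] C(3)
    have ev: "\<forall>\<^sub>F t::real in at_right 0. E (z + of_real t * v) = C (z + of_real t * v)"
      by eventually_elim simp
    have "((\<lambda>t::real. E (z + of_real t * v)) \<longlongrightarrow> E z) (at_right 0)"
      by (rule filterlim_compose[OF _ lim]) (use isE[OF z] in \<open>simp add: isCont_def\<close>)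
    hence "((\<lambda>t::real. C (z + of_real t * v)) \<longlongrightarrow> E z) (at_right 0)"
      by (rule Lim_transform_eventually[OF _ ev])
    moreover have "((\<lambda>t::real. C (z + of_real t * v)) \<longlongrightarrow> C z) (at_right 0)"
      by (rule filterlim_compose[OF _ lim]) (use C(1) in \<open>simp add: isCont_def\<close>)
    ultimately have "E z = C z" using tendsto_unique trivial_limit_at_right_real by blast
    thus ?thesis using C(2) by (simp add: E_def P_def)
  qed
qed

subsection \<open>Subordination\<close>

lemma subordinate_cong:
  assumes "F \<prec>\<prec> G" "\<And>z. z \<in> unit_disc \<Longrightarrow> F' z = F z" "\<And>z. z \<in> unit_disc \<Longrightarrow> G' z = G z"
  shows "F' \<prec>\<prec> G'"
proof -
  from assms(1) obtain w where w: "w holomorphic_on unit_disc" "w 0 = 0"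
    "\<And>z. z \<in> unit_disc \<Longrightarrow> norm (w z) < 1 \<and> F z = G (w z)"
    and hol: "F holomorphic_on unit_disc" "G holomorphic_on unit_disc"
    unfolding subordinate_def by blast
  have "F' holomorphic_on unit_disc" "G' holomorphic_on unit_disc"
    using hol assms(2,3) by (metis holomorphic_transform)+
  moreover have "norm (w z) < 1 \<and> F' z = G' (w z)" if "z \<in> unit_disc" for z
    using w(3)[OF that] assms(2)[OF that] assms(3)[of "w z"] by simp
  ultimately show ?thesis using w(1,2) unfolding subordinate_def by blast
qed

text \<open>The theorem of Hallenbeck and Ruscheweyh for the convex functions \<open>moebius_h A B\<close>.\<close>

lemma euler_subordination:
  fixes P p Q :: "complex \<Rightarrow> complex"
  assumes B: "\<bar>B\<bar> \<le> 1" and AB: "A \<noteq> B" and \<gamma>: "Re \<gamma> > 0" and n: "n \<ge> 1"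
    and Q: "Q holomorphic_on unit_disc"
    and Qeq: "\<And>z. z \<in> unit_disc \<Longrightarrow> Q z + z * deriv Q z / \<gamma> = moebius_h A B z"
    and p: "p holomorphic_on unit_disc"
    and P: "\<And>z. z \<in> unit_disc \<Longrightarrow> P z = 1 + z ^ n * p z"
    and sub: "(\<lambda>z. P z + z * deriv P z / (of_nat n * \<gamma>)) \<prec>\<prec> moebius_h A B"
  shows "P \<prec>\<prec> Q"
proof -
  have \<gamma>0: "\<gamma> \<noteq> 0" using \<gamma> by auto
  have ab: "complex_of_real A - of_real B \<noteq> 0" using AB by simp
  from sub obtain W where W: "W holomorphic_on unit_disc"
    "\<And>z. z \<in> unit_disc \<Longrightarrow> norm (W z) < 1"
    "\<And>z. z \<in> unit_disc \<Longrightarrow> P z + z * deriv P z / (of_nat n * \<gamma>) = moebius_h A B (W z)"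
    unfolding subordinate_def by blast
  define F1 where "F1 z = p z + (of_nat n * p z + z * deriv p z) / (of_nat n * \<gamma>)" for z
  have F1: "P z + z * deriv P z / (of_nat n * \<gamma>) = 1 + z ^ n * F1 z" if z: "z \<in> unit_disc" for z
  proof -
    have "(p has_field_derivative deriv p z) (at z)"
      by (rule holomorphic_derivI[OF p open_ball z])
    hence "((\<lambda>z. 1 + z ^ n * p z) has_field_derivative
        of_nat n * z ^ (n - 1) * p z + z ^ n * deriv p z) (at z)"
      by (auto intro!: derivative_eq_intros)
    hence "(P has_field_derivative of_nat n * z ^ (n - 1) * p z + z ^ n * deriv p z) (at z)"
      by (rule has_field_derivative_transform_within_open[OF _ open_ball z]) (use P in auto)
    hence "z * deriv P z = of_nat n * (z * z ^ (n - 1)) * p z + z ^ n * (z * deriv p z)"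
      by (simp add: DERIV_imp_deriv algebra_simps)
    also have "z * z ^ (n - 1) = z ^ n" using n by (cases n) auto
    finally have "z * deriv P z = z ^ n * (of_nat n * p z + z * deriv p z)"
      by (simp add: algebra_simps)
    thus ?thesis by (simp add: P[OF z] F1_def distrib_left)
  qed
  \<comment> \<open>Obtained by solving \<open>z ^ n * F1 z = moebius_h A B (W z) - 1 = (A - B) W z
    / (1 + B W z)\<close> for the numerator \<open>W z\<close>.\<close>
  define W1 where "W1 z = F1 z * (1 + of_real B * W z) / (of_real A - of_real B)" for z
  have W1: "W1 holomorphic_on unit_disc"
    unfolding W1_def[abs_def] F1_def[abs_def] using n \<gamma>0 ab
    by (intro holomorphic_intros p W) auto
  have WW1: "W z = z ^ n * W1 z" if z: "z \<in> unit_disc" for z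
  proof -
    have nz: "1 + of_real B * W z \<noteq> 0" using one_plus_mult_nonzero[OF B] W(2)[OF z] by auto
    have "moebius_h A B (W z) - 1 = (of_real A - of_real B) * W z / (1 + of_real B * W z)"
      using moebius_h_diff[of B 0 "W z" A] nz by (simp add: moebius_h_def)
    moreover have "moebius_h A B (W z) - 1 = z ^ n * F1 z"
      using F1[OF z] W(3)[OF z] by simp
    ultimately have "z ^ n * F1 z = (of_real A - of_real B) * W z / (1 + of_real B * W z)"
      by simp
    hence "z ^ n * F1 z * (1 + of_real B * W z) = (of_real A - of_real B) * W z"
      unfolding nonzero_eq_divide_eq[OF nz] .
    moreover have "z ^ n * W1 z = z ^ n * F1 z * (1 + of_real B * W z) / (of_real A - of_real B)"
      by (simp add: W1_def mult.assoc)
    ultimately have "z ^ n * W1 z = (of_real A - of_real B) * W z / (of_real A - of_real B)"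
      by simp
    thus ?thesis using ab by simp
  qed
  have Wle: "norm (W z) \<le> norm z ^ n" if z: "z \<in> unit_disc" for z
  proof -
    have "norm (W1 z) \<le> 1"
    proof (rule Schwarz_order[OF W1 _ z, of n])
      show "norm (u ^ n * W1 u) \<le> 1" if "u \<in> unit_disc" for u
        using W(2)[OF that] WW1[OF that] by simp
    qed
    thus ?thesis using mult_left_mono[of "norm (W1 z)" 1 "norm z ^ n"]
      by (simp add: WW1[OF z] norm_mult norm_power)
  qed
  have Q0: "Q 0 = 1" using Qeq[of 0] by (simp add: moebius_h_def)
  show ?thesis
  proof (rule Jack_subordination[OF Q _ p _ n])
    show "inj_on Q unit_disc" by (rule euler_solution_inj_on[OF B AB \<gamma> Q Qeq])
    show "P z = Q 0 + z ^ n * p z" if "z \<in> unit_disc" for z using P[OF that] Q0 by simp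
  next
    fix z \<zeta> :: complex and m :: real
    assume z: "z \<in> unit_disc" and \<zeta>: "\<zeta> \<in> unit_disc" and m: "m \<ge> of_nat n"
      and touch: "P z = Q \<zeta>" "z * deriv P z = of_real m * (\<zeta> * deriv Q \<zeta>)"
    define T where "T = deriv Q \<zeta> * (1 + of_real B * \<zeta>)\<^sup>2 / (\<gamma> * (of_real A - of_real B))"
    have T: "Re T > 0" unfolding T_def by (rule Re_euler_solution_deriv_pos[OF B AB \<gamma> Q Qeq \<zeta>])
    have nz: "1 + of_real B * \<zeta> \<noteq> 0" using one_plus_mult_nonzero[OF B] \<zeta> by auto
    have h': "T * deriv (moebius_h A B) \<zeta> = deriv Q \<zeta> / \<gamma>"
      using nz ab by (simp add: T_def DERIV_imp_deriv[OF moebius_h_has_field_derivative[OF nz]])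
    \<comment> \<open>Euler's equation at \<open>\<zeta>\<close> absorbs one unit of the coefficient
      \<open>m / n\<close>. The surplus is nonnegative as \<open>m \<ge> n\<close>, and
      \<open>h'\<close> rewrites it as a multiple of the derivative of
      \<open>moebius_h A B\<close>.\<close>
    define v where "v = of_real (m / n - 1) * T"
    have v: "Re v \<ge> 0" using m n T by (simp add: v_def field_simps)
    have n0: "of_nat n \<noteq> (0::complex)" using n by simp
    have "moebius_h A B (W z) = Q \<zeta> + of_real m * (\<zeta> * deriv Q \<zeta>) / (of_nat n * \<gamma>)"
      using W(3)[OF z] touch by simp
    also have "\<dots> = (Q \<zeta> + \<zeta> * deriv Q \<zeta> / \<gamma>) + of_real (m / n - 1) * \<zeta> * (deriv Q \<zeta> / \<gamma>)"
      using n0 \<gamma>0 by (simp add: field_simps)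
    also have "\<dots> = moebius_h A B \<zeta> + v * \<zeta> * deriv (moebius_h A B) \<zeta>"
      unfolding Qeq[OF \<zeta>] h'[symmetric] v_def by (simp add: mult_ac)
    finally have "moebius_h A B \<zeta> + v * \<zeta> * deriv (moebius_h A B) \<zeta> = moebius_h A B (W z)" ..
    hence "norm \<zeta> \<le> norm (W z)"
      using moebius_h_outward[OF B AB _ _ v, of \<zeta> "W z"] \<zeta> by (auto simp: not_less[symmetric])
    thus "norm \<zeta> \<le> norm z ^ n" using Wle[OF z] by linarith
  qed
qed

text \<open>Jack's method with order 1: when \<open>Q\<close> touches \<open>moebius_h A B\<close>
  at \<open>\<zeta>\<close>, Euler's equation reaches \<open>moebius_h A B z\<close> by moving
  outward from \<open>moebius_h A B \<zeta>\<close> with \<open>v = m / \<gamma>\<close>, so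
  \<open>norm \<zeta> \<le> norm z\<close> by \<open>moebius_h_outward\<close>.\<close>

lemma euler_solution_subordinate:
  assumes B: "\<bar>B\<bar> \<le> 1" and AB: "A \<noteq> B" and \<gamma>: "Re \<gamma> > 0"
    and Q: "Q holomorphic_on unit_disc"
    and Qeq: "\<And>z. z \<in> unit_disc \<Longrightarrow> Q z + z * deriv Q z / \<gamma> = moebius_h A B z"
  shows "Q \<prec>\<prec> moebius_h A B"
proof -
  have "deriv Q holomorphic_on unit_disc" by (intro holomorphic_intros Q) auto
  hence "\<exists>p. p holomorphic_on unit_disc \<and> (\<forall>z\<in>unit_disc. Q z = Q 0 + z ^ Suc 0 * p z)"
    by (rule diff_at_0_factor[OF Q]) simp
  then obtain p where p: "p holomorphic_on unit_disc"
    "\<And>z. z \<in> unit_disc \<Longrightarrow> Q z = Q 0 + z ^ Suc 0 * p z" by blast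
  have Q0: "Q 0 = moebius_h A B 0" using Qeq[of 0] by simp
  show ?thesis
  proof (rule Jack_subordination[OF moebius_h_holomorphic[OF B] moebius_h_inj_on[OF B AB] p(1) _ order_refl])
    show "Q z = moebius_h A B 0 + z ^ 1 * p z" if "z \<in> unit_disc" for z using p(2)[OF that] Q0 by simp
  next
    fix z \<zeta> :: complex and m :: real
    assume z: "z \<in> unit_disc" and \<zeta>: "\<zeta> \<in> unit_disc" and m: "m \<ge> of_nat 1"
      and touch: "Q z = moebius_h A B \<zeta>"
        "z * deriv Q z = of_real m * (\<zeta> * deriv (moebius_h A B) \<zeta>)"
    define v where "v = of_real m / \<gamma>"
    have v: "Re v \<ge> 0" using m \<gamma> by (simp add: v_def Re_divide)
    have "moebius_h A B \<zeta> + v * \<zeta> * deriv (moebius_h A B) \<zeta> = moebius_h A B z"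
      using Qeq[OF z] touch by (simp add: v_def mult_ac)
    hence "norm \<zeta> \<le> norm z"
      using moebius_h_outward[OF B AB _ _ v, of \<zeta> z] \<zeta> by (auto simp: not_less[symmetric])
    thus "norm \<zeta> \<le> norm z ^ 1" by simp
  qed
qed

section \<open>Class membership as a first-order differential subordination\<close>

text \<open>With \<open>exp (l z) = z ^ p / f z\<close>, the class expression is the principal power
  times \<open>M = 1 + \<mu> / p * z l'\<close>. Its holomorphy identifies the power with
  \<open>E = exp (c l)\<close>, and \<open>E' = c l' E\<close> turns \<open>E M\<close> into the
  stated expression.\<close>

lemma class_N_branch:
  fixes c :: complex
  assumes f: "f \<in> class_N p n \<mu> \<alpha> \<beta> A B" and n: "n \<ge> 1" and p: "p \<ge> 1"
    and c: "c = Complex \<alpha> \<beta>" "c \<noteq> 0"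
  obtains e E where "e holomorphic_on unit_disc"
    "\<And>z. z \<in> unit_disc \<Longrightarrow> power_quot p f z powr c = E z"
    "\<And>z. z \<in> unit_disc \<Longrightarrow> E z = 1 + z ^ n * e z"
    "(\<lambda>z. E z + \<mu> / (of_nat p * c) * (z * deriv E z)) \<prec>\<prec> moebius_h A B"
proof -
  define F where "F z = (1 + \<mu>) * power_quot p f z powr c
          - \<mu> * log_deriv_quot p f z * power_quot p f z powr c" for z
  have fA: "f \<in> class_A p n" and sub: "F \<prec>\<prec> moebius_h A B"
    using f unfolding class_N_def F_def[abs_def] c by auto
  from class_A_factor[OF fA n p] obtain g where g: "g holomorphic_on unit_disc"
    and fg: "\<And>z. z \<in> unit_disc \<Longrightarrow> f z = z ^ p * (1 + z ^ n * g z)"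
    and gnz: "\<And>z. z \<in> unit_disc \<Longrightarrow> 1 + z ^ n * g z \<noteq> 0" by metis
  define k where "k z = 1 + z ^ n * g z" for z
  have k: "k holomorphic_on unit_disc" unfolding k_def[abs_def] by (intro holomorphic_intros g)
  have knz: "k z \<noteq> 0" and fk: "f z = z ^ p * k z" if "z \<in> unit_disc" for z
    using gnz fg that by (auto simp: k_def)
  have k0: "k 0 = 1" using n by (simp add: k_def)
  have dk: "(k has_field_derivative deriv k z) (at z)" if "z \<in> unit_disc" for z
    by (rule holomorphic_derivI[OF k open_ball that])
  have "contractible (unit_disc :: complex set)" by (intro convex_imp_contractible convex_ball)
  from contractible_imp_holomorphic_log[OF k this knz] obtain l0
    where l0: "l0 holomorphic_on unit_disc" "\<And>z. z \<in> unit_disc \<Longrightarrow> k z = exp (l0 z)" by metis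
  \<comment> \<open>The logarithm \<open>l0\<close> of \<open>k\<close> may differ from 0 at the
    origin; the constant normalises \<open>l\<close> to \<open>l 0 = 0\<close>.\<close>
  define l where "l z = l0 0 - l0 z" for z
  have l: "l holomorphic_on unit_disc" "l 0 = 0"
    unfolding l_def[abs_def] by (auto intro!: holomorphic_intros l0)
  have expl: "exp (l z) = 1 / k z" if "z \<in> unit_disc" for z
    using l0(2)[OF that] l0(2)[of 0] k0 by (simp add: l_def exp_diff)
  have dl: "(l has_field_derivative deriv l z) (at z)" if "z \<in> unit_disc" for z
    by (rule holomorphic_derivI[OF l(1) open_ball that])
  have l': "deriv l z = - deriv k z / k z" if z: "z \<in> unit_disc" for z
  proof -
    have "((\<lambda>z. exp (l z) * k z) has_field_derivative
        exp (l z) * deriv l z * k z + exp (l z) * deriv k z) (at z)"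
      using dl[OF z] dk[OF z] by (auto intro!: derivative_eq_intros)
    moreover have "((\<lambda>z. exp (l z) * k z) has_field_derivative 0) (at z)"
      by (rule has_field_derivative_transform_within_open[OF DERIV_const open_ball z])
        (use expl knz in auto)
    ultimately have "exp (l z) * deriv l z * k z + exp (l z) * deriv k z = 0"
      by (rule DERIV_unique)
    hence "exp (l z) * (deriv l z * k z + deriv k z) = 0" by (simp add: algebra_simps)
    hence "deriv l z * k z + deriv k z = 0" by simp
    thus ?thesis using knz[OF z] by (simp add: field_simps add_eq_0_iff)
  qed
  have pq: "power_quot p f z = exp (l z)" if "z \<in> unit_disc" for z
    using expl[OF that] fk[OF that] k0 by (auto simp: power_quot_def)
  define M where "M z = 1 + \<mu> / of_nat p * (z * deriv l z)" for z
  have M: "M holomorphic_on unit_disc" unfolding M_def[abs_def]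
    by (intro holomorphic_intros l) (use p in auto)
  have lq: "1 + \<mu> - \<mu> * log_deriv_quot p f z = M z" if z: "z \<in> unit_disc" for z
  proof (cases "z = 0")
    case True
    thus ?thesis by (simp add: log_deriv_quot_def M_def)
  next
    case False
    have "((\<lambda>z. z ^ p * k z) has_field_derivative of_nat p * z ^ (p - 1) * k z + z ^ p * deriv k z) (at z)"
      using dk[OF z] by (auto intro!: derivative_eq_intros)
    hence "(f has_field_derivative of_nat p * z ^ (p - 1) * k z + z ^ p * deriv k z) (at z)"
      by (rule has_field_derivative_transform_within_open[OF _ open_ball z]) (use fk in auto)
    hence "z * deriv f z = of_nat p * (z * z ^ (p - 1)) * k z + z ^ p * (z * deriv k z)"
      by (simp add: DERIV_imp_deriv algebra_simps)
    also have "z * z ^ (p - 1) = z ^ p" using p by (cases p) auto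
    finally have "z * deriv f z = z ^ p * (of_nat p * k z + z * deriv k z)"
      by (simp add: algebra_simps)
    hence "log_deriv_quot p f z = (z ^ p * (of_nat p * k z + z * deriv k z)) / (z ^ p * (of_nat p * k z))"
      using False by (simp add: log_deriv_quot_def fk[OF z] mult_ac)
    also have "\<dots> = 1 + z * deriv k z / (of_nat p * k z)"
      using False knz[OF z] p by (simp add: field_simps)
    finally have "log_deriv_quot p f z = 1 - z * deriv l z / of_nat p"
      using l'[OF z] by simp
    thus ?thesis by (simp add: M_def right_diff_distrib)
  qed
  have Feq: "F z = exp (l z) powr c * M z" if "z \<in> unit_disc" for z
    unfolding F_def pq[OF that] lq[OF that, symmetric] by (simp add: algebra_simps)
  have "F holomorphic_on unit_disc" using sub by (simp add: subordinate_def)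
  hence hol: "(\<lambda>z. exp (l z) powr c * M z) holomorphic_on unit_disc"
    by (rule holomorphic_transform) (use Feq in auto)
  define E where "E z = exp (c * l z)" for z
  have E: "E holomorphic_on unit_disc" unfolding E_def[abs_def] by (intro holomorphic_intros l)
  \<comment> \<open>At a zero of \<open>M\<close> the derivative of \<open>l\<close> is nonzero,
    since otherwise \<open>M\<close> would be 1 there.\<close>
  have PE: "exp (l z) powr c = E z" if z: "z \<in> unit_disc" for z
    unfolding E_def by (rule powr_eq_holomorphic_branch[OF l M _ hol _ z]) (auto simp: M_def)
  have E': "deriv E z = c * deriv l z * E z" if z: "z \<in> unit_disc" for z
  proof -
    have "(E has_field_derivative c * deriv l z * E z) (at z)"
      unfolding E_def[abs_def] using dl[OF z] by (auto intro!: derivative_eq_intros)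
    thus ?thesis by (rule DERIV_imp_deriv)
  qed
  obtain e where e: "e holomorphic_on unit_disc" "\<And>z. z \<in> unit_disc \<Longrightarrow> E z = E 0 + z ^ Suc (n - 1) * e z"
  proof -
    \<comment> \<open>From \<open>E' = - c k' / k * E\<close> with \<open>z ^ (n - 1)\<close> taken
      out of \<open>k'\<close>. Integration raises the exponent to
      \<open>Suc (n - 1) = n\<close>.\<close>
    define G where "G z = - c * (of_nat n * g z + z * deriv g z) / k z * E z" for z
    have "G holomorphic_on unit_disc" unfolding G_def[abs_def]
      by (intro holomorphic_intros g k E) (use knz in auto)
    moreover have "deriv E z = z ^ (n - 1) * G z" if z: "z \<in> unit_disc" for z
    proof -
      have "(k has_field_derivative of_nat n * z ^ (n - 1) * g z + z ^ n * deriv g z) (at z)"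
        unfolding k_def[abs_def] using holomorphic_derivI[OF g open_ball z]
        by (auto intro!: derivative_eq_intros)
      hence "deriv k z = of_nat n * z ^ (n - 1) * g z + z ^ n * deriv g z" by (rule DERIV_imp_deriv)
      also have "z ^ n = z ^ (n - 1) * z" using n by (cases n) auto
      finally have "deriv k z = z ^ (n - 1) * (of_nat n * g z + z * deriv g z)"
        by (simp add: algebra_simps)
      thus ?thesis by (simp add: E'[OF z] l'[OF z] G_def)
    qed
    ultimately show ?thesis using diff_at_0_factor[OF E, of G "n - 1"] that by blast
  qed
  show ?thesis
  proof (rule that[OF e(1)])
    show "power_quot p f z powr c = E z" if "z \<in> unit_disc" for z
      using pq[OF that] PE[OF that] by simp
    show "E z = 1 + z ^ n * e z" if "z \<in> unit_disc" for z
      using e(2)[OF that] n l(2) by (simp add: E_def)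
    show "(\<lambda>z. E z + \<mu> / (of_nat p * c) * (z * deriv E z)) \<prec>\<prec> moebius_h A B"
    proof (rule subordinate_cong[OF sub])
      show "E z + \<mu> / (of_nat p * c) * (z * deriv E z) = F z" if "z \<in> unit_disc" for z
        using c(2) p unfolding Feq[OF that] PE[OF that] E'[OF that] M_def
        by (simp add: field_simps)
    qed simp
  qed
qed

theorem theorem2p1:
  fixes n p :: nat and \<mu> :: complex and \<alpha> \<beta> A B :: real and f :: "complex \<Rightarrow> complex"
  assumes "n \<ge> 1" and "p \<ge> 1"
    and "\<alpha> \<ge> 0" and "-1 \<le> B" and "B \<le> 1" and "A \<noteq> B"
    and "Complex \<alpha> \<beta> \<noteq> 0"
    and \<mu>_nonzero: "\<mu> \<noteq> 0"
    and integral_exists: "\<And>z. z \<in> unit_disc \<Longrightarrow>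
      (\<lambda>u::real. moebius_h A B (z * of_real u) *
         of_real u powr (of_nat p * Complex \<alpha> \<beta> / (\<mu> * of_nat n) - 1)) integrable_on {0..1}"
    and "f \<in> class_N p n \<mu> \<alpha> \<beta> A B"
  shows "(\<lambda>z. power_quot p f z powr Complex \<alpha> \<beta>) \<prec>\<prec>
           (\<lambda>z. of_nat p * Complex \<alpha> \<beta> / (\<mu> * of_nat n) *
              integral {0..1} (\<lambda>u::real. moebius_h A B (z * of_real u) *
                of_real u powr (of_nat p * Complex \<alpha> \<beta> / (\<mu> * of_nat n) - 1))) \<and>
         (\<lambda>z. of_nat p * Complex \<alpha> \<beta> / (\<mu> * of_nat n) *
              integral {0..1} (\<lambda>u::real. moebius_h A B (z * of_real u) *
                of_real u powr (of_nat p * Complex \<alpha> \<beta> / (\<mu> * of_nat n) - 1)))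
           \<prec>\<prec> moebius_h A B"
proof -
  define c where "c = Complex \<alpha> \<beta>"
  define \<gamma> where "\<gamma> = of_nat p * c / (\<mu> * of_nat n)"
  have c: "c \<noteq> 0" using \<open>Complex \<alpha> \<beta> \<noteq> 0\<close> by (simp add: c_def)
  have \<gamma>0: "\<gamma> \<noteq> 0" using c \<mu>_nonzero \<open>n \<ge> 1\<close> \<open>p \<ge> 1\<close> by (simp add: \<gamma>_def)
  have B: "\<bar>B\<bar> \<le> 1" using \<open>-1 \<le> B\<close> \<open>B \<le> 1\<close> by simp
  \<comment> \<open>At \<open>z = 0\<close> the integrand reduces to
    \<open>u powr (\<gamma> - 1)\<close>.\<close>
  have \<gamma>: "Re \<gamma> > 0"
    using integral_exists[of 0] \<gamma>0
    by (intro Re_pos_if_powr_integrable) (simp_all add: moebius_h_def \<gamma>_def c_def)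
  from euler_equation_solvable[OF moebius_h_holomorphic[OF B] \<gamma>, of A] obtain Q
    where Q: "Q holomorphic_on unit_disc"
      and Qeq: "\<And>z. z \<in> unit_disc \<Longrightarrow> Q z + z * deriv Q z / \<gamma> = moebius_h A B z" by blast
  have int: "\<gamma> * integral {0..1} (\<lambda>u::real. moebius_h A B (z * of_real u) * of_real u powr (\<gamma> - 1)) = Q z"
    if "z \<in> unit_disc" for z
    using integral_unique[OF euler_equation_integral[OF Q \<gamma> Qeq that]] \<gamma>0 by simp
  obtain e E
    where e: "e holomorphic_on unit_disc"
      and PE: "\<And>z. z \<in> unit_disc \<Longrightarrow> power_quot p f z powr c = E z"
      and Ee: "\<And>z. z \<in> unit_disc \<Longrightarrow> E z = 1 + z ^ n * e z"
      and sub: "(\<lambda>z. E z + \<mu> / (of_nat p * c) * (z * deriv E z)) \<prec>\<prec> moebius_h A B"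
    by (rule class_N_branch[OF \<open>f \<in> class_N p n \<mu> \<alpha> \<beta> A B\<close> \<open>n \<ge> 1\<close> \<open>p \<ge> 1\<close> c_def c]) blast
  \<comment> \<open>The definition of \<open>\<gamma>\<close> amounts to
    \<open>n \<gamma> = p c / \<mu>\<close>, which matches the two forms of the differential
    expression.\<close>
  have "\<mu> / (of_nat p * c) = 1 / (of_nat n * \<gamma>)"
    using c \<mu>_nonzero \<open>n \<ge> 1\<close> \<open>p \<ge> 1\<close> by (simp add: \<gamma>_def)
  with sub have "(\<lambda>z. E z + z * deriv E z / (of_nat n * \<gamma>)) \<prec>\<prec> moebius_h A B" by simp
  from euler_subordination[OF B \<open>A \<noteq> B\<close> \<gamma> \<open>n \<ge> 1\<close> Q Qeq e Ee this]
  have "E \<prec>\<prec> Q" .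
  hence "(\<lambda>z. power_quot p f z powr c) \<prec>\<prec>
      (\<lambda>z. \<gamma> * integral {0..1} (\<lambda>u::real. moebius_h A B (z * of_real u) * of_real u powr (\<gamma> - 1)))"
    by (rule subordinate_cong) (use PE int in auto)
  moreover have "(\<lambda>z. \<gamma> * integral {0..1} (\<lambda>u::real. moebius_h A B (z * of_real u) * of_real u powr (\<gamma> - 1)))
      \<prec>\<prec> moebius_h A B"
    by (rule subordinate_cong[OF euler_solution_subordinate[OF B \<open>A \<noteq> B\<close> \<gamma> Q Qeq]])
      (use int in auto)
  ultimately show ?thesis by (simp add: \<gamma>_def c_def)
qed

end
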